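(* Let $(\epsilon_1,\epsilon_2)\in\{(-1,-1),(-1,1),(1,-1)\}$ and $\epsilon=-\epsilon_1\epsilon_2$. Let $L$ be the simply connected Lie group with Lie algebra $\mathfrak{l}$ and $\bar g$ the left-invariant metric on $L$ defined by the scalar product $\langle\cdot,\cdot\rangle$ on $\mathfrak{l}$, as given in the context. Then the pseudo-Riemannian manifold $(L,\bar g)$ is locally symmetric: $\nabla R=0$, where $\nabla$ is the Levi-Civita connection and $R$ the curvature tensor of $\bar g$.
   Context: The Lie algebra $\mathfrak{l}$ has basis $(T_1,\dots,T_8)=(V_2,U^2,A,B,V_0,V_1,U^0,U^1)$ with brackets (all not determined by these and skew-symmetry vanish): $[B,A]=\frac1{\sqrt3}A$, $[U^2,V_2]=V_2$, $[V_0,U^0]=-V_2$, $[V_1,U^1]=-V_2$, $[U^2,V_I]=\frac12V_I$ and $[U^2,U^I]=\frac12U^I$ for $I=0,1$, $[B,V_0]=-\frac{\sqrt3}2V_0$, $[B,V_1]=-\frac1{2\sqrt3}V_1$, $[B,U^0]=\frac{\sqrt3}2U^0$, $[B,U^1]=\frac1{2\sqrt3}U^1$, $[A,V_0]=V_1$, $[A,U^1]=-U^0$, $[A,V_1]=-\frac2{\sqrt3}U^1$. The scalar product $\langle\cdot,\cdot\rangle$ has Gram matrix $\mathrm{diag}(-\epsilon_1,1,-\epsilon_1,1,-\epsilon,-\epsilon_2,-\epsilon_2,-\epsilon)$ in this basis. *)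

theory Defs
  imports "HOL-Analysis.Analysis" "HOL-Algebra.Group" "HOL-Library.Function_Algebras"
begin

section \<open>Smooth maps between open subsets of Euclidean spaces\<close>

text \<open>Only meant for open \<open>S\<close>, where \<^const>\<open>frechet_derivative\<close> is determined by \<open>f\<close> on \<open>S\<close>.\<close>

primrec Ck_on :: "nat \<Rightarrow> 'b::euclidean_space set \<Rightarrow> ('b \<Rightarrow> 'c::euclidean_space) \<Rightarrow> bool" where
  "Ck_on 0 S f \<longleftrightarrow> continuous_on S f"
| "Ck_on (Suc k) S f \<longleftrightarrow>
     (\<forall>x\<in>S. f differentiable (at x)) \<and>
     (\<forall>v. Ck_on k S (\<lambda>x. frechet_derivative f (at x) v))"

definition smooth_on :: "'b::euclidean_space set \<Rightarrow> ('b \<Rightarrow> 'c::euclidean_space) \<Rightarrow> bool" where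
  "smooth_on S f \<longleftrightarrow> (\<forall>k. Ck_on k S f)"


section \<open>Smooth manifolds\<close>

text \<open>A manifold is a whole topological type \<open>'a\<close> with an atlas modelled on the Euclidean
  space \<open>'e\<close>. The value of the chart map of \<open>(U, \<phi>)\<close> outside \<open>U\<close> is irrelevant.\<close>

type_synonym ('a, 'e) atlas = "('a set \<times> ('a \<Rightarrow> 'e)) set"

definition smooth_atlas :: "('a::topological_space, 'e::euclidean_space) atlas \<Rightarrow> bool" where
  "smooth_atlas \<A> \<longleftrightarrow>
     (\<Union>(U, \<phi>)\<in>\<A>. U) = UNIV \<and>
     (\<forall>(U, \<phi>)\<in>\<A>. open U \<and> open (\<phi> ` U) \<and> homeomorphism U (\<phi> ` U) \<phi> (inv_into U \<phi>)) \<and>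
     (\<forall>(U, \<phi>)\<in>\<A>. \<forall>(V, \<psi>)\<in>\<A>. smooth_on (\<phi> ` (U \<inter> V)) (\<psi> \<circ> inv_into U \<phi>))"

definition product_atlas ::
  "('a, 'e) atlas \<Rightarrow> ('b, 'f) atlas \<Rightarrow> ('a \<times> 'b, 'e \<times> 'f) atlas" where
  "product_atlas \<A> \<B> = {(U \<times> V, map_prod \<phi> \<psi>) | U \<phi> V \<psi>. (U, \<phi>) \<in> \<A> \<and> (V, \<psi>) \<in> \<B>}"

definition smooth_map ::
  "('a::topological_space, 'e::euclidean_space) atlas \<Rightarrow>
   ('b::topological_space, 'f::euclidean_space) atlas \<Rightarrow> ('a \<Rightarrow> 'b) \<Rightarrow> bool" where
  "smooth_map \<A> \<B> F \<longleftrightarrow>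
     continuous_on UNIV F \<and>
     (\<forall>(U, \<phi>)\<in>\<A>. \<forall>(V, \<psi>)\<in>\<B>. smooth_on (\<phi> ` (U \<inter> F -` V)) (\<psi> \<circ> F \<circ> inv_into U \<phi>))"

definition smooth_fun_on ::
  "('a::topological_space, 'e::euclidean_space) atlas \<Rightarrow> 'a set \<Rightarrow> ('a \<Rightarrow> real) \<Rightarrow> bool" where
  "smooth_fun_on \<A> W f \<longleftrightarrow> (\<forall>(U, \<phi>)\<in>\<A>. smooth_on (\<phi> ` (U \<inter> W)) (f \<circ> inv_into U \<phi>))"

definition smooth_near ::
  "('a::topological_space, 'e::euclidean_space) atlas \<Rightarrow> 'a \<Rightarrow> ('a \<Rightarrow> real) \<Rightarrow> bool" where
  "smooth_near \<A> p f \<longleftrightarrow> (\<exists>W. open W \<and> p \<in> W \<and> smooth_fun_on \<A> W f)"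


section \<open>Tangent vectors and vector fields\<close>

text \<open>Tangent vectors at \<open>p\<close> are derivations on the functions that are smooth near \<open>p\<close>. The Leibniz
  rule, applied to the indicator function of a neighbourhood of \<open>p\<close>, makes them depend on germs
  only. Extending them by 0 to all other functions makes them equal iff they agree as derivations.\<close>

type_synonym 'a tangent = "('a \<Rightarrow> real) \<Rightarrow> real"
type_synonym 'a vector_field = "'a \<Rightarrow> 'a tangent"

definition tangent_space ::
  "('a::topological_space, 'e::euclidean_space) atlas \<Rightarrow> 'a \<Rightarrow> 'a tangent set" where
  "tangent_space \<A> p = {v.
     (\<forall>f h. smooth_near \<A> p f \<longrightarrow> smooth_near \<A> p h \<longrightarrow> v (\<lambda>q. f q + h q) = v f + v h) \<and>
     (\<forall>c f. smooth_near \<A> p f \<longrightarrow> v (\<lambda>q. c * f q) = c * v f) \<and>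
     (\<forall>f h. smooth_near \<A> p f \<longrightarrow> smooth_near \<A> p h \<longrightarrow>
        v (\<lambda>q. f q * h q) = v f * h p + f p * v h) \<and>
     (\<forall>f. \<not> smooth_near \<A> p f \<longrightarrow> v f = 0)}"

definition push_forward ::
  "('a::topological_space, 'e::euclidean_space) atlas \<Rightarrow> ('a \<Rightarrow> 'a) \<Rightarrow> 'a \<Rightarrow> 'a tangent \<Rightarrow> 'a tangent"
  where "push_forward \<A> F p v = (\<lambda>f. if smooth_near \<A> (F p) f then v (f \<circ> F) else 0)"

definition deriv_along :: "'a vector_field \<Rightarrow> ('a \<Rightarrow> real) \<Rightarrow> 'a \<Rightarrow> real" where
  "deriv_along X f = (\<lambda>p. X p f)"

definition vector_fields ::
  "('a::topological_space, 'e::euclidean_space) atlas \<Rightarrow> 'a vector_field set" where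
  "vector_fields \<A> = {X.
     (\<forall>p. X p \<in> tangent_space \<A> p) \<and>
     (\<forall>W f. open W \<longrightarrow> smooth_fun_on \<A> W f \<longrightarrow> smooth_fun_on \<A> W (deriv_along X f))}"

definition fun_scale :: "('a \<Rightarrow> real) \<Rightarrow> 'a vector_field \<Rightarrow> 'a vector_field" where
  "fun_scale h X = (\<lambda>p f. h p * X p f)"

definition lie_bracket ::
  "('a::topological_space, 'e::euclidean_space) atlas \<Rightarrow>
   'a vector_field \<Rightarrow> 'a vector_field \<Rightarrow> 'a vector_field" where
  "lie_bracket \<A> X Y = (\<lambda>p f.
     if smooth_near \<A> p f then X p (deriv_along Y f) - Y p (deriv_along X f) else 0)"


section \<open>Pseudo-Riemannian metrics, the Levi-Civita connection and curvature\<close>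

text \<open>The index is not required to be constant; this is automatic on connected manifolds.\<close>

type_synonym 'a metric_tensor = "'a \<Rightarrow> 'a tangent \<Rightarrow> 'a tangent \<Rightarrow> real"

definition inner_fields ::
  "'a metric_tensor \<Rightarrow> 'a vector_field \<Rightarrow> 'a vector_field \<Rightarrow> 'a \<Rightarrow> real" where
  "inner_fields g X Y = (\<lambda>p. g p (X p) (Y p))"

definition pseudo_riemannian_metric ::
  "('a::topological_space, 'e::euclidean_space) atlas \<Rightarrow> 'a metric_tensor \<Rightarrow> bool" where
  "pseudo_riemannian_metric \<A> g \<longleftrightarrow>
     (\<forall>p. \<forall>u\<in>tangent_space \<A> p. \<forall>v\<in>tangent_space \<A> p. g p u v = g p v u) \<and>
     (\<forall>p. \<forall>u\<in>tangent_space \<A> p. \<forall>v\<in>tangent_space \<A> p. \<forall>w\<in>tangent_space \<A> p.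
        g p (u + v) w = g p u w + g p v w) \<and>
     (\<forall>p c. \<forall>u\<in>tangent_space \<A> p. \<forall>w\<in>tangent_space \<A> p. g p (\<lambda>f. c * u f) w = c * g p u w) \<and>
     (\<forall>p. \<forall>u\<in>tangent_space \<A> p. (\<forall>v\<in>tangent_space \<A> p. g p u v = 0) \<longrightarrow> u = 0) \<and>
     (\<forall>X\<in>vector_fields \<A>. \<forall>Y\<in>vector_fields \<A>. smooth_fun_on \<A> UNIV (inner_fields g X Y))"

type_synonym 'a connection = "'a vector_field \<Rightarrow> 'a vector_field \<Rightarrow> 'a vector_field"

definition affine_connection ::
  "('a::topological_space, 'e::euclidean_space) atlas \<Rightarrow> 'a connection \<Rightarrow> bool" where
  "affine_connection \<A> D \<longleftrightarrow>
     (\<forall>X\<in>vector_fields \<A>. \<forall>Y\<in>vector_fields \<A>. D X Y \<in> vector_fields \<A>) \<and>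
     (\<forall>X\<in>vector_fields \<A>. \<forall>Y\<in>vector_fields \<A>. \<forall>Z\<in>vector_fields \<A>.
        D (X + Y) Z = D X Z + D Y Z \<and> D X (Y + Z) = D X Y + D X Z) \<and>
     (\<forall>h. smooth_fun_on \<A> UNIV h \<longrightarrow> (\<forall>X\<in>vector_fields \<A>. \<forall>Y\<in>vector_fields \<A>.
        D (fun_scale h X) Y = fun_scale h (D X Y) \<and>
        D X (fun_scale h Y) = fun_scale (deriv_along X h) Y + fun_scale h (D X Y)))"

definition levi_civita_connection ::
  "('a::topological_space, 'e::euclidean_space) atlas \<Rightarrow> 'a metric_tensor \<Rightarrow> 'a connection \<Rightarrow> bool"
  where
  "levi_civita_connection \<A> g D \<longleftrightarrow>
     affine_connection \<A> D \<and>
     (\<forall>X\<in>vector_fields \<A>. \<forall>Y\<in>vector_fields \<A>. D X Y - D Y X = lie_bracket \<A> X Y) \<and>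
     (\<forall>X\<in>vector_fields \<A>. \<forall>Y\<in>vector_fields \<A>. \<forall>Z\<in>vector_fields \<A>.
        deriv_along X (inner_fields g Y Z) = inner_fields g (D X Y) Z + inner_fields g Y (D X Z))"

definition curvature ::
  "('a::topological_space, 'e::euclidean_space) atlas \<Rightarrow> 'a connection \<Rightarrow>
   'a vector_field \<Rightarrow> 'a vector_field \<Rightarrow> 'a vector_field \<Rightarrow> 'a vector_field" where
  "curvature \<A> D X Y Z = D X (D Y Z) - D Y (D X Z) - D (lie_bracket \<A> X Y) Z"

definition nabla_curvature ::
  "('a::topological_space, 'e::euclidean_space) atlas \<Rightarrow> 'a connection \<Rightarrow>
   'a vector_field \<Rightarrow> 'a vector_field \<Rightarrow> 'a vector_field \<Rightarrow> 'a vector_field \<Rightarrow> 'a vector_field"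
  where
  "nabla_curvature \<A> D W X Y Z =
     D W (curvature \<A> D X Y Z) - curvature \<A> D (D W X) Y Z
     - curvature \<A> D X (D W Y) Z - curvature \<A> D X Y (D W Z)"

text \<open>The Levi-Civita connection exists and is unique on vector fields, so quantifying over all
  connections \<open>D\<close> with the defining properties speaks about this one connection.\<close>

definition locally_symmetric ::
  "('a::topological_space, 'e::euclidean_space) atlas \<Rightarrow> 'a metric_tensor \<Rightarrow> bool" where
  "locally_symmetric \<A> g \<longleftrightarrow>
     (\<forall>D. levi_civita_connection \<A> g D \<longrightarrow>
        (\<forall>W\<in>vector_fields \<A>. \<forall>X\<in>vector_fields \<A>. \<forall>Y\<in>vector_fields \<A>. \<forall>Z\<in>vector_fields \<A>.
           nabla_curvature \<A> D W X Y Z = 0))"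


section \<open>Lie groups\<close>

definition lie_group ::
  "('a::{t2_space,second_countable_topology}, 'e::euclidean_space) atlas \<Rightarrow> 'a monoid \<Rightarrow> bool" where
  "lie_group \<A> L \<longleftrightarrow>
     smooth_atlas \<A> \<and> group L \<and> carrier L = UNIV \<and>
     smooth_map (product_atlas \<A> \<A>) \<A> (\<lambda>(x, y). x \<otimes>\<^bsub>L\<^esub> y) \<and>
     smooth_map \<A> \<A> (\<lambda>x. inv\<^bsub>L\<^esub> x)"

definition left_invariant_fields ::
  "('a::topological_space, 'e::euclidean_space) atlas \<Rightarrow> 'a monoid \<Rightarrow> 'a vector_field set" where
  "left_invariant_fields \<A> L = {X \<in> vector_fields \<A>.
     \<forall>a p. push_forward \<A> (\<lambda>x. a \<otimes>\<^bsub>L\<^esub> x) p (X p) = X (a \<otimes>\<^bsub>L\<^esub> p)}"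

definition left_invariant_metric ::
  "('a::topological_space, 'e::euclidean_space) atlas \<Rightarrow> 'a monoid \<Rightarrow> 'a metric_tensor \<Rightarrow> bool" where
  "left_invariant_metric \<A> L g \<longleftrightarrow>
     pseudo_riemannian_metric \<A> g \<and>
     (\<forall>a p. \<forall>u\<in>tangent_space \<A> p. \<forall>v\<in>tangent_space \<A> p.
        g (a \<otimes>\<^bsub>L\<^esub> p)
          (push_forward \<A> (\<lambda>x. a \<otimes>\<^bsub>L\<^esub> x) p u) (push_forward \<A> (\<lambda>x. a \<otimes>\<^bsub>L\<^esub> x) p v) = g p u v)"

text \<open>\<open>\<Theta>\<close> is an isomorphism from the Lie algebra \<open>(real ^ 'n, br)\<close> onto the Lie algebra of \<open>L\<close>,
  that is, the left-invariant vector fields with the commutator. Linearity is spelled out because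
  functions are not an instance of the class of real vector spaces.\<close>

definition lie_algebra_iso ::
  "('a::topological_space, 'e::euclidean_space) atlas \<Rightarrow> 'a monoid \<Rightarrow>
   (real ^ 'n \<Rightarrow> real ^ 'n \<Rightarrow> real ^ 'n) \<Rightarrow> (real ^ 'n \<Rightarrow> 'a vector_field) \<Rightarrow> bool" where
  "lie_algebra_iso \<A> L br \<Theta> \<longleftrightarrow>
     bij_betw \<Theta> UNIV (left_invariant_fields \<A> L) \<and>
     (\<forall>u v. \<Theta> (u + v) = \<Theta> u + \<Theta> v) \<and>
     (\<forall>c u. \<Theta> (c *\<^sub>R u) = fun_scale (\<lambda>_. c) (\<Theta> u)) \<and>
     (\<forall>u v. \<Theta> (br u v) = lie_bracket \<A> (\<Theta> u) (\<Theta> v))"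


section \<open>The Lie algebra and its scalar product\<close>

datatype l_index = V2 | U2 | A | B | V0 | V1 | U0 | U1

instance l_index :: finite
proof
  have "(UNIV :: l_index set) = {V2, U2, A, B, V0, V1, U0, U1}"
    using l_index.exhaust by blast
  then show "finite (UNIV :: l_index set)"
    by (metis finite.emptyI finite.insertI)
qed

text \<open>Each unordered pair of basis vectors with nonzero bracket is listed in one order;
  \<open>l_bracket\<close> is the skew-symmetric bilinear extension.\<close>

fun l_table :: "l_index \<Rightarrow> l_index \<Rightarrow> real ^ l_index" where
  "l_table B A = (1 / sqrt 3) *\<^sub>R axis A 1"
| "l_table U2 V2 = axis V2 1"
| "l_table V0 U0 = - axis V2 1"
| "l_table V1 U1 = - axis V2 1"
| "l_table U2 V0 = (1 / 2) *\<^sub>R axis V0 1"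
| "l_table U2 V1 = (1 / 2) *\<^sub>R axis V1 1"
| "l_table U2 U0 = (1 / 2) *\<^sub>R axis U0 1"
| "l_table U2 U1 = (1 / 2) *\<^sub>R axis U1 1"
| "l_table B V0 = - (sqrt 3 / 2) *\<^sub>R axis V0 1"
| "l_table B V1 = - (1 / (2 * sqrt 3)) *\<^sub>R axis V1 1"
| "l_table B U0 = (sqrt 3 / 2) *\<^sub>R axis U0 1"
| "l_table B U1 = (1 / (2 * sqrt 3)) *\<^sub>R axis U1 1"
| "l_table A V0 = axis V1 1"
| "l_table A U1 = - axis U0 1"
| "l_table A V1 = - (2 / sqrt 3) *\<^sub>R axis U1 1"
| "l_table _ _ = 0"

definition l_bracket :: "real ^ l_index \<Rightarrow> real ^ l_index \<Rightarrow> real ^ l_index" where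
  "l_bracket u v = (\<Sum>i\<in>UNIV. \<Sum>j\<in>UNIV. (u $ i * v $ j) *\<^sub>R (l_table i j - l_table j i))"

fun l_gram :: "real \<Rightarrow> real \<Rightarrow> real \<Rightarrow> l_index \<Rightarrow> real" where
  "l_gram \<epsilon>1 \<epsilon>2 \<epsilon> V2 = - \<epsilon>1"
| "l_gram \<epsilon>1 \<epsilon>2 \<epsilon> U2 = 1"
| "l_gram \<epsilon>1 \<epsilon>2 \<epsilon> A = - \<epsilon>1"
| "l_gram \<epsilon>1 \<epsilon>2 \<epsilon> B = 1"
| "l_gram \<epsilon>1 \<epsilon>2 \<epsilon> V0 = - \<epsilon>"
| "l_gram \<epsilon>1 \<epsilon>2 \<epsilon> V1 = - \<epsilon>2"
| "l_gram \<epsilon>1 \<epsilon>2 \<epsilon> U0 = - \<epsilon>2"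
| "l_gram \<epsilon>1 \<epsilon>2 \<epsilon> U1 = - \<epsilon>"

definition l_scalar ::
  "real \<Rightarrow> real \<Rightarrow> real \<Rightarrow> real ^ l_index \<Rightarrow> real ^ l_index \<Rightarrow> real" where
  "l_scalar \<epsilon>1 \<epsilon>2 \<epsilon> u v = (\<Sum>i\<in>UNIV. l_gram \<epsilon>1 \<epsilon>2 \<epsilon> i * u $ i * v $ i)"

end

(* Every derivation at a point is determined by its values on chart coordinates (Hadamard's lemma).
   The left-invariant fields are orthogonal of constant nonzero length and as many as the dimension,
   so every vector field is a combination of them with smooth coefficients. Since \<nabla>R is tensorial,
   it suffices to evaluate it on the left-invariant frame, where the Koszul formula turns everything
   into constants. Rescaling the basis by 2 and 2 sqrt 3 makes these constants integers. *)

theory Submission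
  imports Defs
begin

section \<open>Calculus of smooth maps\<close>

text \<open>A tangent vector is an abstract derivation on germs, so nothing bounds the dimension of
  a tangent space beforehand. Chart coordinates give the upper bound, and orthogonality gives that
  many independent vectors. Tensoriality usually calls for cutoff functions, because coefficients
  exist only locally; here the frame is global, so multipliers smooth on the whole manifold suffice.
  The scale factors have an arithmetic origin. A nonzero structure constant of the given basis is a
  rational multiple of sqrt 3 when an odd number of its three indices lie in {A, B, V1, U1}, and
  rational otherwise. An extra factor sqrt 3 on these four vectors therefore makes all constants
  rational; the common factor 2 clears the halves left in the brackets and those produced by the
  Koszul formula. The final identity is compared between operators rather than vectors, so the
  vector on which R(X,Y) acts disappears from the computation.\<close>

lemma Ck_on_subset: "Ck_on k S f \<Longrightarrow> T \<subseteq> S \<Longrightarrow> Ck_on k T f"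
  by (induction k arbitrary: f) (auto intro: continuous_on_subset)

lemma Ck_on_cong_open:
  assumes "Ck_on k S f" "open S" "\<And>x. x \<in> S \<Longrightarrow> f x = g x"
  shows "Ck_on k S g"
  using assms
proof (induction k arbitrary: f g)
  case 0
  then show ?case by (auto cong: continuous_on_cong)
next
  case (Suc k)
  have *: "g differentiable at x \<and> frechet_derivative f (at x) = frechet_derivative g (at x)"
    if x: "x \<in> S" for x
  proof -
    have "(f has_derivative frechet_derivative f (at x)) (at x)"
      using Suc.prems(1) x frechet_derivative_works by auto
    then have "(g has_derivative frechet_derivative f (at x)) (at x)"
      by (rule has_derivative_transform_within_open) (use Suc.prems x in auto)
    then show ?thesis
      using frechet_derivative_at differentiable_def by blast
  qed
  have "Ck_on k S (\<lambda>x. frechet_derivative g (at x) v)" for v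
    by (rule Suc.IH[where f = "\<lambda>x. frechet_derivative f (at x) v"]) (use Suc.prems * in auto)
  with * show ?case by auto
qed

lemma Ck_on_Suc_derivative:
  "Ck_on (Suc k) S f \<Longrightarrow> x \<in> S \<Longrightarrow> (f has_derivative frechet_derivative f (at x)) (at x)"
  using frechet_derivative_works by auto

text \<open>By uniqueness of derivatives on an open set, any explicit formula \<open>f'\<close> may
  stand in for \<open>frechet_derivative\<close>.\<close>

lemma Ck_on_SucI:
  assumes "open S" "\<And>x. x \<in> S \<Longrightarrow> (f has_derivative f' x) (at x)"
    and "\<And>v. Ck_on k S (\<lambda>x. f' x v)"
  shows "Ck_on (Suc k) S f"
  unfolding Ck_on.simps
proof (intro conjI ballI allI)
  show "f differentiable at x" if "x \<in> S" for x
    using assms(2)[OF that] differentiable_def by blast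
  show "Ck_on k S (\<lambda>x. frechet_derivative f (at x) v)" for v
    by (rule Ck_on_cong_open[OF assms(3)[of v] assms(1)])
      (use assms(2) frechet_derivative_at in metis)
qed

lemma Ck_on_SucD: "Ck_on (Suc k) S f \<Longrightarrow> Ck_on k S f"
proof (induction k arbitrary: f)
  case 0
  then show ?case
    by (auto intro!: continuous_at_imp_continuous_on differentiable_imp_continuous_within)
next
  case (Suc k)
  then show ?case by (metis Ck_on.simps(2))
qed

lemma Ck_on_imp_continuous_on: "Ck_on k S f \<Longrightarrow> continuous_on S f"
proof (induction k)
  case (Suc k)
  then show ?case using Ck_on_SucD by blast
qed simp

lemma Ck_on_const: "Ck_on k S (\<lambda>x. c)"
  by (induction k arbitrary: c) auto

lemma Ck_on_bounded_linear:
  assumes "bounded_linear f"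
  shows "Ck_on k S f"
proof (cases k)
  case 0
  then show ?thesis using assms by (simp add: linear_continuous_on)
next
  case (Suc j)
  have "frechet_derivative f (at x) = f" for x
    using assms bounded_linear_imp_has_derivative frechet_derivative_at by metis
  then show ?thesis
    using Suc assms bounded_linear_imp_differentiable by (auto simp: Ck_on_const)
qed

lemma Ck_on_compose_linear:
  assumes "bounded_linear h" "open S" "Ck_on k S f"
  shows "Ck_on k S (\<lambda>x. h (f x))"
  using assms(3)
proof (induction k arbitrary: f)
  case 0
  then show ?case using assms(1) by (simp add: bounded_linear.continuous_on)
next
  case (Suc k)
  show ?case
    by (rule Ck_on_SucI[OF assms(2) bounded_linear.has_derivative[OF assms(1)
          Ck_on_Suc_derivative[OF Suc.prems]]])
      (use Suc in auto)
qed

lemma Ck_on_add: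
  assumes "open S" "Ck_on k S f" "Ck_on k S g"
  shows "Ck_on k S (\<lambda>x. f x + g x)"
  using assms(2,3)
proof (induction k arbitrary: f g)
  case 0
  then show ?case by (simp add: continuous_on_add)
next
  case (Suc k)
  show ?case
    by (rule Ck_on_SucI[OF assms(1) has_derivative_add[OF
          Ck_on_Suc_derivative[OF Suc.prems(1)] Ck_on_Suc_derivative[OF Suc.prems(2)]]])
      (use Suc in auto)
qed

lemma Ck_on_sum:
  assumes "open S" "\<And>i. i \<in> I \<Longrightarrow> Ck_on k S (f i)"
  shows "Ck_on k S (\<lambda>x. \<Sum>i\<in>I. f i x)"
  using assms(2)
  by (induction I rule: infinite_finite_induct) (auto intro: Ck_on_add assms(1) simp: Ck_on_const)

lemma Ck_on_scaleR:
  fixes f :: "'b::euclidean_space \<Rightarrow> real" and g :: "'b \<Rightarrow> 'c::euclidean_space"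
  assumes "open S" "Ck_on k S f" "Ck_on k S g"
  shows "Ck_on k S (\<lambda>x. f x *\<^sub>R g x)"
  using assms(2,3)
proof (induction k arbitrary: f g)
  case 0
  then show ?case by (simp add: continuous_on_scaleR)
next
  case (Suc k)
  show ?case
  proof (rule Ck_on_SucI[OF assms(1) has_derivative_scaleR[OF
          Ck_on_Suc_derivative[OF Suc.prems(1)] Ck_on_Suc_derivative[OF Suc.prems(2)]]])
    show "Ck_on k S (\<lambda>x. f x *\<^sub>R frechet_derivative g (at x) v + frechet_derivative f (at x) v *\<^sub>R g x)"
      for v
      using Suc by (intro Ck_on_add assms(1) Suc.IH Ck_on_SucD[OF Suc.prems(1)] 
           Ck_on_SucD[OF Suc.prems(2)]) auto
  qed
qed

text \<open>\<open>Ck_on\<close> controls derivatives in a fixed direction, whereas the chain rule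
  differentiates f in the direction Dg(x) v, which moves with x. Expanding this direction in
  \<open>Basis\<close> leaves fixed directions with scalar coefficients, to which the induction
  hypothesis and the product rule apply.\<close>

lemma Ck_on_compose:
  assumes "open S" "open T" "g ` S \<subseteq> T" "Ck_on k S g" "Ck_on k T f"
  shows "Ck_on k S (\<lambda>x. f (g x))"
  using assms(4,5)
proof (induction k arbitrary: f)
  case 0
  then show ?case
    using assms(3) by (auto intro: continuous_on_compose2)
next
  case (Suc k)
  show ?case
  proof (rule Ck_on_SucI[OF assms(1)])
    show "((\<lambda>x. f (g x)) has_derivative
        (\<lambda>v. \<Sum>b\<in>Basis. (frechet_derivative g (at x) v \<bullet> b) *\<^sub>R frechet_derivative f (at (g x)) b)) (at x)"
      if "x \<in> S" for x
    proof -
      have df: "(f has_derivative frechet_derivative f (at (g x))) (at (g x))"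
        using Ck_on_Suc_derivative[OF Suc.prems(2)] assms(3) that by blast
      have dg: "(g has_derivative frechet_derivative g (at x)) (at x)"
        using Ck_on_Suc_derivative[OF Suc.prems(1)] that by blast
      interpret linear "frechet_derivative f (at (g x))"
        using df has_derivative_linear by blast
      have "frechet_derivative f (at (g x)) w = (\<Sum>b\<in>Basis. (w \<bullet> b) *\<^sub>R frechet_derivative f (at (g x)) b)"
        for w
        by (subst euclidean_representation[symmetric, of w]) (simp only: sum scaleR)
      then show ?thesis
        by (intro has_derivative_eq_rhs[OF has_derivative_compose[OF dg df]] ext)
    qed
    show "Ck_on k S (\<lambda>x. \<Sum>b\<in>Basis. (frechet_derivative g (at x) v \<bullet> b) *\<^sub>R frechet_derivative f (at (g x)) b)"
      for v
      using Suc.prems 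
      by (intro Ck_on_sum Ck_on_scaleR assms(1) Ck_on_compose_linear[OF bounded_linear_inner_left]
          Suc.IH[where f = "\<lambda>y. frechet_derivative f (at y) _"] Ck_on_SucD[OF Suc.prems(1)]) auto
  qed
qed

section \<open>Integrals along rays and Hadamard's lemma\<close>

text \<open>The power of t makes the induction go through: differentiating under the integral in
  direction v gives an integral of the same shape, with m + 1 for m and the directional derivative
  of F for F. Convexity keeps the segments from a inside S.\<close>

lemma Ck_on_ray_integral:
  fixes F :: "'b::euclidean_space \<Rightarrow> real"
  assumes S: "open S" "convex S" "a \<in> S" and F: "Ck_on k S F"
  shows "Ck_on k S (\<lambda>x. integral {0..1} (\<lambda>t. t ^ m * F (a + t *\<^sub>R (x - a))))"
  using F
proof (induction k arbitrary: F m)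
  case 0
  have mem: "a + t *\<^sub>R (x - a) \<in> S" if "x \<in> S" "t \<in> {0..1}" for x t
    using that S convexD_alt[OF S(2,3) that(1), of t] by (simp add: algebra_simps)
  have "continuous_on (S \<times> cbox 0 1) (\<lambda>(x, t). t ^ m * F (a + t *\<^sub>R (x - a)))"
    using 0 mem by (auto simp: split_beta intro!: continuous_intros continuous_on_compose2[of S F])
  from integral_continuous_on_param[OF this] show ?case by simp
next
  case (Suc k)
  have mem: "a + t *\<^sub>R (x - a) \<in> S" if "x \<in> S" "t \<in> {0..1}" for x t
    using that S convexD_alt[OF S(2,3) that(1), of t] by (simp add: algebra_simps)
  define F' where "F' = (\<lambda>x. frechet_derivative F (at x))"
  have F': "(F has_derivative F' x) (at x)" if "x \<in> S" for x
    using Ck_on_Suc_derivative[OF Suc.prems that] by (simp add: F'_def)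
  have F'k: "Ck_on k S (\<lambda>x. F' x v)" for v
    using Suc.prems by (simp add: F'_def)
  have bl: "bounded_linear (\<lambda>v. t ^ Suc m * F' (a + t *\<^sub>R (x - a)) v)"
    if "x \<in> S" "t \<in> {0..1}" for x t
    using F'[OF mem[OF that]] has_derivative_bounded_linear bounded_linear_mult_const
      bounded_linear_const_mult by blast
  \<comment> \<open>\<open>leibniz_rule\<close> takes the derivative as a continuous family of
    bounded linear maps; in finite dimension its continuity can be tested on basis vectors.\<close>
  define G where "G = (\<lambda>x t. Blinfun (\<lambda>v. t ^ Suc m * F' (a + t *\<^sub>R (x - a)) v))"
  have G: "blinfun_apply (G x t) = (\<lambda>v. t ^ Suc m * F' (a + t *\<^sub>R (x - a)) v)"
    if "x \<in> S" "t \<in> {0..1}" for x t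
    unfolding G_def by (rule bounded_linear_Blinfun_apply[OF bl[OF that]])
  have contG: "continuous_on (S \<times> {0..1}) (\<lambda>(x,t). G x t)"
  proof (rule continuous_on_blinfun_componentwise)
    fix i :: 'b
    have "continuous_on (S \<times> {0..1}) (\<lambda>z. snd z ^ Suc m * F' (a + snd z *\<^sub>R (fst z - a)) i)"
      using mem
      by (intro continuous_intros continuous_on_compose2[OF Ck_on_imp_continuous_on[OF F'k[of i]]]) auto
    then show "continuous_on (S \<times> {0..1}) (\<lambda>x. blinfun_apply (case x of (x, t) \<Rightarrow> G x t) i)"
      by (rule continuous_on_eq) (auto simp: G)
  qed
  have int1: "(\<lambda>t. t ^ m * F (a + t *\<^sub>R (x - a))) integrable_on {0..1}" if "x \<in> S" for x
    using mem that
    by (intro integrable_continuous_real continuous_intros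
        continuous_on_compose2[OF Ck_on_imp_continuous_on[OF Suc.prems]]) auto
  have der: "((\<lambda>x. integral {0..1} (\<lambda>t. t ^ m * F (a + t *\<^sub>R (x - a)))) has_derivative
      (\<lambda>v. integral {0..1} (\<lambda>t. t ^ Suc m * F' (a + t *\<^sub>R (x - a)) v))) (at x)" if x: "x \<in> S" for x
  proof -
    have "((\<lambda>x. integral (cbox 0 1) (\<lambda>t. t ^ m * F (a + t *\<^sub>R (x - a)))) has_derivative
       blinfun_apply (integral (cbox 0 1) (G x))) (at x within S)"
    proof (rule leibniz_rule[OF _ _ _ x S(2)])
      show "((\<lambda>x. t ^ m * F (a + t *\<^sub>R (x - a))) has_derivative blinfun_apply (G x t)) (at x within S)"
        if "x \<in> S" "t \<in> cbox 0 1" for x t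
      proof -
        have t: "t \<in> {0..1}" using that by simp
        interpret linear "F' (a + t *\<^sub>R (x - a))"
          using F'[OF mem[OF that(1) t]] has_derivative_linear by blast
        have "((\<lambda>x. a + t *\<^sub>R (x - a)) has_derivative (\<lambda>v. t *\<^sub>R v)) (at x)"
          by (auto intro!: derivative_eq_intros)
        from has_derivative_mult_right[OF has_derivative_compose[OF this F'[OF mem[OF that(1) t]]], of "t ^ m"]
        have "((\<lambda>x. t ^ m * F (a + t *\<^sub>R (x - a))) has_derivative
            (\<lambda>v. t ^ m * F' (a + t *\<^sub>R (x - a)) (t *\<^sub>R v))) (at x)" .
        then have "((\<lambda>x. t ^ m * F (a + t *\<^sub>R (x - a))) has_derivative
            (\<lambda>v. t ^ Suc m * F' (a + t *\<^sub>R (x - a)) v)) (at x)"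
          by (simp only: scale real_scaleR_def power_Suc2 mult.assoc)
        then show ?thesis
          unfolding G[OF that(1) t] by (rule has_derivative_at_withinI)
      qed
    qed (use int1 contG in auto)
    moreover have "blinfun_apply (integral (cbox 0 1) (G x)) v =
        integral {0..1} (\<lambda>t. t ^ Suc m * F' (a + t *\<^sub>R (x - a)) v)" for v
    proof -
      have "continuous_on {0..1} (G x)"
        using continuous_on_compose2[OF contG, of "{0..1}" "Pair x"] x
        by (force intro: continuous_on_Pair continuous_on_const continuous_on_id)
      then have "G x integrable_on cbox 0 1"
        by (intro integrable_continuous) simp
      then have "blinfun_apply (integral (cbox 0 1) (G x)) v
          = integral (cbox 0 1) (\<lambda>t. blinfun_apply (G x t) v)"
        by (rule blinfun_apply_integral)
      also have "\<dots> = integral {0..1} (\<lambda>t. t ^ Suc m * F' (a + t *\<^sub>R (x - a)) v)"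
        by (auto intro!: integral_cong simp: G[OF x] simp del: power_Suc)
      finally show ?thesis .
    qed
    ultimately have "((\<lambda>x. integral (cbox 0 1) (\<lambda>t. t ^ m * F (a + t *\<^sub>R (x - a)))) has_derivative
       (\<lambda>v. integral {0..1} (\<lambda>t. t ^ Suc m * F' (a + t *\<^sub>R (x - a)) v))) (at x within S)"
      by (elim has_derivative_eq_rhs) (rule ext)
    then show ?thesis
      using at_within_open[OF x S(1)] by simp
  qed
  show ?case
    by (rule Ck_on_SucI[OF S(1) der]) (assumption, rule Suc.IH[OF F'k])
qed

lemma smooth_on_subset: "smooth_on S f \<Longrightarrow> T \<subseteq> S \<Longrightarrow> smooth_on T f"
  unfolding smooth_on_def using Ck_on_subset by blast

lemma smooth_on_cong_open:
  "smooth_on S f \<Longrightarrow> open S \<Longrightarrow> (\<And>x. x \<in> S \<Longrightarrow> f x = g x) \<Longrightarrow> smooth_on S g"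
  unfolding smooth_on_def using Ck_on_cong_open by blast

lemma smooth_on_const: "smooth_on S (\<lambda>x. c)"
  unfolding smooth_on_def using Ck_on_const by blast

lemma smooth_on_bounded_linear: "bounded_linear f \<Longrightarrow> smooth_on S f"
  unfolding smooth_on_def using Ck_on_bounded_linear by blast

lemma smooth_on_add:
  "open S \<Longrightarrow> smooth_on S f \<Longrightarrow> smooth_on S g \<Longrightarrow> smooth_on S (\<lambda>x. f x + g x)"
  unfolding smooth_on_def using Ck_on_add by blast

lemma smooth_on_mult:
  fixes f g :: "'b::euclidean_space \<Rightarrow> real"
  shows "open S \<Longrightarrow> smooth_on S f \<Longrightarrow> smooth_on S g \<Longrightarrow> smooth_on S (\<lambda>x. f x * g x)"
  unfolding smooth_on_def using Ck_on_scaleR[of S _ f g] by simp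

lemma smooth_on_compose:
  "open S \<Longrightarrow> open T \<Longrightarrow> g ` S \<subseteq> T \<Longrightarrow> smooth_on S g \<Longrightarrow> smooth_on T f \<Longrightarrow> smooth_on S (\<lambda>x. f (g x))"
  unfolding smooth_on_def using Ck_on_compose by blast

lemma smooth_on_has_derivative:
  "smooth_on S f \<Longrightarrow> x \<in> S \<Longrightarrow> (f has_derivative frechet_derivative f (at x)) (at x)"
  unfolding smooth_on_def using Ck_on_Suc_derivative by blast

text \<open>The witness \<open>h b\<close> is the average of a partial derivative of f along the
  segment from a to x. The expansion is the fundamental theorem of calculus on that segment; at x =
  a the integrand is constant.\<close>

lemma hadamard:
  fixes f :: "'b::euclidean_space \<Rightarrow> real"
  assumes S: "open S" "convex S" "a \<in> S" and f: "smooth_on S f"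
  obtains h where "\<And>b. smooth_on S (h b)"
    and "\<And>x. x \<in> S \<Longrightarrow> f x = f a + (\<Sum>b\<in>Basis. ((x - a) \<bullet> b) * h b x)"
    and "\<And>b. h b a = frechet_derivative f (at a) b"
proof
  \<comment> \<open>The factor \<open>t ^ 0\<close> puts the integral into the shape of
    \<open>Ck_on_ray_integral\<close>.\<close>
  let ?h = "\<lambda>b x. integral {0..1} (\<lambda>t. t ^ 0 * frechet_derivative f (at (a + t *\<^sub>R (x - a))) b)"
  have mem: "a + t *\<^sub>R (x - a) \<in> S" if "x \<in> S" "t \<in> {0..1}" for x t
    using that S convexD_alt[OF S(2,3) that(1), of t] by (simp add: algebra_simps)
  have Ck: "Ck_on k S (\<lambda>x. frechet_derivative f (at x) b)" for k b
    using f[unfolded smooth_on_def, rule_format, of "Suc k"] by simp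
  show "smooth_on S (?h b)" for b
    unfolding smooth_on_def
    by (intro allI Ck_on_ray_integral[where F = "\<lambda>x. frechet_derivative f (at x) b"] S Ck)
  show "?h b a = frechet_derivative f (at a) b" for b
    by simp
  show "f x = f a + (\<Sum>b\<in>Basis. ((x - a) \<bullet> b) * ?h b x)" if x: "x \<in> S" for x
  proof -
    have d: "((\<lambda>t. f (a + t *\<^sub>R (x - a))) has_vector_derivative
        frechet_derivative f (at (a + t *\<^sub>R (x - a))) (x - a)) (at t within {0..1})"
      if "t \<in> {0..1}" for t
    proof -
      have "((\<lambda>t. a + t *\<^sub>R (x - a)) has_derivative (\<lambda>s. s *\<^sub>R (x - a))) (at t)"
        by (auto intro!: derivative_eq_intros)
      from has_derivative_compose[OF this smooth_on_has_derivative[OF f mem[OF x that]]]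
      have "((\<lambda>t. f (a + t *\<^sub>R (x - a))) has_derivative
         (\<lambda>s. frechet_derivative f (at (a + t *\<^sub>R (x - a))) (s *\<^sub>R (x - a)))) (at t)" .
      then show ?thesis
        unfolding has_vector_derivative_def
        using linear_frechet_derivative[OF differentiableI[OF smooth_on_has_derivative[OF f mem[OF x that]]]]
        by (simp add: linear_scale has_derivative_at_withinI)
    qed
    have "((\<lambda>t. frechet_derivative f (at (a + t *\<^sub>R (x - a))) (x - a)) has_integral f x - f a) {0..1}"
      using fundamental_theorem_of_calculus[OF _ d] by simp
    moreover have "frechet_derivative f (at (a + t *\<^sub>R (x - a))) (x - a)
       = (\<Sum>b\<in>Basis. ((x - a) \<bullet> b) * frechet_derivative f (at (a + t *\<^sub>R (x - a))) b)"
      if "t \<in> {0..1}" for t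
    proof -
      interpret linear "frechet_derivative f (at (a + t *\<^sub>R (x - a)))"
        by (rule linear_frechet_derivative[OF differentiableI[OF smooth_on_has_derivative[OF f mem[OF x that]]]])
      show ?thesis
        by (subst euclidean_representation[symmetric, of "x - a"]) (simp only: sum scaleR real_scaleR_def)
    qed
    ultimately have "((\<lambda>t. \<Sum>b\<in>Basis. ((x - a) \<bullet> b) * frechet_derivative f (at (a + t *\<^sub>R (x - a))) b)
        has_integral f x - f a) {0..1}"
      by (rule has_integral_eq[rotated]) auto
    moreover have "((\<lambda>t. \<Sum>b\<in>Basis. ((x - a) \<bullet> b) * frechet_derivative f (at (a + t *\<^sub>R (x - a))) b)
        has_integral (\<Sum>b\<in>Basis. ((x - a) \<bullet> b) * ?h b x)) {0..1}"
    proof (intro has_integral_sum has_integral_mult_right)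
      fix b :: 'b
      have "continuous_on {0..1} (\<lambda>t. frechet_derivative f (at (a + t *\<^sub>R (x - a))) b)"
        using mem[OF x]
        by (intro continuous_on_compose2[OF Ck_on_imp_continuous_on[OF Ck[of 0 b]]] continuous_intros) auto
      then show "((\<lambda>t. frechet_derivative f (at (a + t *\<^sub>R (x - a))) b) has_integral ?h b x) {0..1}"
        by (simp add: integrable_continuous_real integrable_integral)
    qed simp
    ultimately have "f x - f a = (\<Sum>b\<in>Basis. ((x - a) \<bullet> b) * ?h b x)"
      by (rule has_integral_unique)
    then show ?thesis by simp
  qed
qed


section \<open>Tangent vectors and vector fields on a manifold\<close>

locale smooth_manifold =
  fixes \<A> :: "('a::topological_space, 'e::euclidean_space) atlas"
  assumes atlas: "smooth_atlas \<A>"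
begin

section \<open>Charts\<close>

lemma chart_exists: obtains U \<phi> where "(U, \<phi>) \<in> \<A>" "p \<in> U"
proof -
  have "p \<in> (\<Union>(U, \<phi>)\<in>\<A>. U)"
    using atlas unfolding smooth_atlas_def by simp
  then show thesis using that by auto
qed

lemma chart_homeomorphism: "(U, \<phi>) \<in> \<A> \<Longrightarrow> homeomorphism U (\<phi> ` U) \<phi> (inv_into U \<phi>)"
  and chart_open: "(U, \<phi>) \<in> \<A> \<Longrightarrow> open U"
  and chart_open_image: "(U, \<phi>) \<in> \<A> \<Longrightarrow> open (\<phi> ` U)"
  using atlas unfolding smooth_atlas_def by auto

lemma chart_transition:
  "(U, \<phi>) \<in> \<A> \<Longrightarrow> (V, \<psi>) \<in> \<A> \<Longrightarrow> smooth_on (\<phi> ` (U \<inter> V)) (\<lambda>x. \<psi> (inv_into U \<phi> x))"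
  using atlas unfolding smooth_atlas_def o_def by fast

lemma chart_inv: "(U, \<phi>) \<in> \<A> \<Longrightarrow> q \<in> U \<Longrightarrow> inv_into U \<phi> (\<phi> q) = q"
  using chart_homeomorphism homeomorphism_apply1 by blast

lemma chart_image_open:
  assumes "(U, \<phi>) \<in> \<A>" "open W"
  shows "open (\<phi> ` (U \<inter> W))"
proof -
  have "openin (top_of_set (\<phi> ` U)) (\<phi> ` (U \<inter> W))"
    by (rule homeomorphism_imp_open_map[OF chart_homeomorphism[OF assms(1)]]) (use assms(2) in auto)
  then show ?thesis
    using chart_open_image[OF assms(1)] openin_open_trans by blast
qed

lemma chart_preimage_open:
  assumes "(U, \<phi>) \<in> \<A>" "open T"
  shows "open (U \<inter> \<phi> -` T)"
  using continuous_open_preimage[OF homeomorphism_cont1[OF chart_homeomorphism[OF assms(1)]]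
      chart_open[OF assms(1)] assms(2)] .

section \<open>Smooth functions and their germs\<close>

lemma smooth_fun_on_mono: "smooth_fun_on \<A> W f \<Longrightarrow> W' \<subseteq> W \<Longrightarrow> smooth_fun_on \<A> W' f"
  unfolding smooth_fun_on_def using smooth_on_subset by (fastforce intro: smooth_on_subset)

lemma smooth_fun_on_cong:
  assumes "smooth_fun_on \<A> W f" "open W" "\<And>q. q \<in> W \<Longrightarrow> f q = h q"
  shows "smooth_fun_on \<A> W h"
  unfolding smooth_fun_on_def
proof safe
  fix U \<phi> assume U: "(U, \<phi>) \<in> \<A>"
  have "smooth_on (\<phi> ` (U \<inter> W)) (f \<circ> inv_into U \<phi>)"
    using assms(1) U unfolding smooth_fun_on_def by auto
  then show "smooth_on (\<phi> ` (U \<inter> W)) (h \<circ> inv_into U \<phi>)"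
    by (rule smooth_on_cong_open) (use assms U chart_image_open chart_inv in auto)
qed

lemma smooth_fun_on_const: "smooth_fun_on \<A> W (\<lambda>q. c)"
  unfolding smooth_fun_on_def by (auto simp: o_def smooth_on_const)

lemma smooth_fun_on_add:
  "open W \<Longrightarrow> smooth_fun_on \<A> W f \<Longrightarrow> smooth_fun_on \<A> W h \<Longrightarrow> smooth_fun_on \<A> W (\<lambda>q. f q + h q)"
  unfolding smooth_fun_on_def o_def by (fastforce intro: smooth_on_add chart_image_open)

lemma smooth_fun_on_mult:
  "open W \<Longrightarrow> smooth_fun_on \<A> W f \<Longrightarrow> smooth_fun_on \<A> W h \<Longrightarrow> smooth_fun_on \<A> W (\<lambda>q. f q * h q)"
  unfolding smooth_fun_on_def o_def by (fastforce intro: smooth_on_mult chart_image_open)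

text \<open>Used to carry the Hadamard coefficients, defined on a ball of the model space, back to
  the manifold.\<close>

lemma smooth_fun_on_chart_compose:
  assumes U: "(U, \<phi>) \<in> \<A>" and T: "open T" and h: "smooth_on T h"
  shows "smooth_fun_on \<A> (U \<inter> \<phi> -` T) (\<lambda>q. h (\<phi> q))"
  unfolding smooth_fun_on_def
proof safe
  fix V \<psi> assume V: "(V, \<psi>) \<in> \<A>"
  show "smooth_on (\<psi> ` (V \<inter> (U \<inter> \<phi> -` T))) ((\<lambda>q. h (\<phi> q)) \<circ> inv_into V \<psi>)"
    unfolding o_def
  proof (rule smooth_on_compose[OF _ T _ _ h])
    show "open (\<psi> ` (V \<inter> (U \<inter> \<phi> -` T)))"
      by (rule chart_image_open[OF V chart_preimage_open[OF U T]])
    show "smooth_on (\<psi> ` (V \<inter> (U \<inter> \<phi> -` T))) (\<lambda>x. \<phi> (inv_into V \<psi> x))"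
      by (rule smooth_on_subset[OF chart_transition[OF V U]]) auto
  qed (auto simp: chart_inv[OF V])
qed

lemma smooth_fun_on_coordinate:
  assumes "(U, \<phi>) \<in> \<A>"
  shows "smooth_fun_on \<A> U (\<lambda>q. \<phi> q \<bullet> b)"
  using smooth_fun_on_chart_compose[OF assms open_UNIV
      smooth_on_bounded_linear[OF bounded_linear_inner_left]] by simp

lemma smooth_nearI: "open W \<Longrightarrow> p \<in> W \<Longrightarrow> smooth_fun_on \<A> W f \<Longrightarrow> smooth_near \<A> p f"
  unfolding smooth_near_def by blast

lemma smooth_near_const: "smooth_near \<A> p (\<lambda>q. c)"
  using smooth_nearI[OF open_UNIV] smooth_fun_on_const by blast

lemma
  assumes "smooth_near \<A> p f" "smooth_near \<A> p h"
  shows smooth_near_add: "smooth_near \<A> p (\<lambda>q. f q + h q)"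
    and smooth_near_mult: "smooth_near \<A> p (\<lambda>q. f q * h q)"
proof -
  obtain W W' where W: "open W" "p \<in> W" "smooth_fun_on \<A> W f"
    and W': "open W'" "p \<in> W'" "smooth_fun_on \<A> W' h"
    using assms unfolding smooth_near_def by (elim exE conjE) simp
  have I: "open (W \<inter> W')" "p \<in> W \<inter> W'"
    using W W' by auto
  have fh: "smooth_fun_on \<A> (W \<inter> W') f" "smooth_fun_on \<A> (W \<inter> W') h"
    using W(3) W'(3) by (auto elim: smooth_fun_on_mono)
  show "smooth_near \<A> p (\<lambda>q. f q + h q)"
    by (rule smooth_nearI[OF I smooth_fun_on_add[OF I(1) fh]])
  show "smooth_near \<A> p (\<lambda>q. f q * h q)"
    by (rule smooth_nearI[OF I smooth_fun_on_mult[OF I(1) fh]])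
qed

lemma smooth_near_sum:
  "(\<And>i. i \<in> I \<Longrightarrow> smooth_near \<A> p (f i)) \<Longrightarrow> smooth_near \<A> p (\<lambda>q. \<Sum>i\<in>I. f i q)"
  by (induction I rule: infinite_finite_induct) (auto intro: smooth_near_add simp: smooth_near_const)

lemma smooth_near_cong:
  assumes "smooth_near \<A> p f" "open W" "p \<in> W" "\<And>q. q \<in> W \<Longrightarrow> f q = h q"
  shows "smooth_near \<A> p h"
proof -
  obtain W' where W': "open W'" "p \<in> W'" "smooth_fun_on \<A> W' f"
    using assms(1) unfolding smooth_near_def by blast
  have "smooth_fun_on \<A> (W \<inter> W') h"
    by (rule smooth_fun_on_cong[OF smooth_fun_on_mono[OF W'(3)]]) (use W' assms in auto)
  then show ?thesis
    using W' assms smooth_nearI[of "W \<inter> W'"] by blast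
qed

section \<open>Derivations at a point\<close>

context
  fixes p v
  assumes v: "v \<in> tangent_space \<A> p"
begin

lemma tangent_add:
  "smooth_near \<A> p f \<Longrightarrow> smooth_near \<A> p h \<Longrightarrow> v (\<lambda>q. f q + h q) = v f + v h"
  and tangent_scale: "smooth_near \<A> p f \<Longrightarrow> v (\<lambda>q. c * f q) = c * v f"
  and tangent_mult:
  "smooth_near \<A> p f \<Longrightarrow> smooth_near \<A> p h \<Longrightarrow> v (\<lambda>q. f q * h q) = v f * h p + f p * v h"
  and tangent_not_smooth: "\<not> smooth_near \<A> p f \<Longrightarrow> v f = 0"
  using v unfolding tangent_space_def by auto

text \<open>Leibniz on 1 = 1 * 1 forces v 1 = 2 v 1.\<close>

lemma tangent_const: "v (\<lambda>q. c) = 0"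
  using tangent_mult[OF smooth_near_const[of p 1] smooth_near_const[of p 1]]
    tangent_scale[OF smooth_near_const[of p 1], of c] by simp

lemma tangent_sum:
  "(\<And>i. i \<in> I \<Longrightarrow> smooth_near \<A> p (f i)) \<Longrightarrow> v (\<lambda>q. \<Sum>i\<in>I. f i q) = (\<Sum>i\<in>I. v (f i))"
  by (induction I rule: infinite_finite_induct)
    (auto simp: tangent_const tangent_add smooth_near_sum)

text \<open>The indicator of W is smooth near p and equals its own square, so the Leibniz rule makes
  v vanish on it. Multiplying by it thus changes neither v f nor v h, yet makes f and h equal
  everywhere; it takes the place of a bump function.\<close>

lemma tangent_local:
  assumes f: "smooth_near \<A> p f" and W: "open W" "p \<in> W" "\<And>q. q \<in> W \<Longrightarrow> f q = h q"
  shows "v f = v h"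
proof -
  define ind :: "'a \<Rightarrow> real" where "ind = indicator W"
  have ind: "smooth_near \<A> p ind"
    by (rule smooth_near_cong[OF smooth_near_const[of p 1] W(1,2)]) (simp add: ind_def)
  have indp: "ind p = 1"
    using W by (simp add: ind_def)
  have h: "smooth_near \<A> p h"
    using smooth_near_cong[OF f W] .
  have "(\<lambda>q. ind q * ind q) = ind"
    by (auto simp: ind_def indicator_def)
  then have "v ind = 0"
    using tangent_mult[OF ind ind] indp by simp
  then have "v (\<lambda>q. f q * ind q) = v f" "v (\<lambda>q. h q * ind q) = v h"
    using tangent_mult[OF f ind] tangent_mult[OF h ind] indp by simp_all
  moreover have "(\<lambda>q. f q * ind q) = (\<lambda>q. h q * ind q)"
    using W(3) by (auto simp: ind_def indicator_def)
  ultimately show ?thesis by simp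
qed

text \<open>In the Hadamard expansion every summand has a first factor vanishing at p, so Leibniz
  keeps only the derivative of the coordinate times the value of \<open>h b\<close> at the base
  point; the constant f p is killed.\<close>

lemma tangent_in_chart:
  assumes U: "(U, \<phi>) \<in> \<A>" "p \<in> U" and f: "smooth_near \<A> p f"
  shows "v f = (\<Sum>b\<in>Basis. v (\<lambda>q. \<phi> q \<bullet> b) * frechet_derivative (f \<circ> inv_into U \<phi>) (at (\<phi> p)) b)"
proof -
  obtain W where W: "open W" "p \<in> W" "smooth_fun_on \<A> W f"
    using f unfolding smooth_near_def by blast
  have "open (\<phi> ` (U \<inter> W))" "\<phi> p \<in> \<phi> ` (U \<inter> W)"
    using chart_image_open[OF U(1) W(1)] U W by auto
  then obtain r where r: "r > 0" "ball (\<phi> p) r \<subseteq> \<phi> ` (U \<inter> W)"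
    using open_contains_ball by blast
  \<comment> \<open>A ball, because Hadamard's lemma asks for a convex domain.\<close>
  define S where "S = ball (\<phi> p) r"
  have S: "open S" "convex S" "\<phi> p \<in> S"
    using r by (auto simp: S_def)
  have "smooth_on (\<phi> ` (U \<inter> W)) (f \<circ> inv_into U \<phi>)"
    using W(3) U(1) unfolding smooth_fun_on_def by auto
  then have "smooth_on S (f \<circ> inv_into U \<phi>)"
    by (rule smooth_on_subset) (use r in \<open>simp add: S_def\<close>)
  from hadamard[OF S this] obtain h where h: "\<And>b. smooth_on S (h b)"
    "\<And>x. x \<in> S \<Longrightarrow> (f \<circ> inv_into U \<phi>) x
       = (f \<circ> inv_into U \<phi>) (\<phi> p) + (\<Sum>b\<in>Basis. ((x - \<phi> p) \<bullet> b) * h b x)"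
    "\<And>b. h b (\<phi> p) = frechet_derivative (f \<circ> inv_into U \<phi>) (at (\<phi> p)) b"
    by blast
  define N where "N = U \<inter> \<phi> -` S"
  have N: "open N" "p \<in> N"
    using chart_preimage_open[OF U(1) S(1)] U S by (auto simp: N_def)
  have x: "smooth_near \<A> p (\<lambda>q. \<phi> q \<bullet> b)" for b
    by (rule smooth_nearI[OF chart_open[OF U(1)] U(2) smooth_fun_on_coordinate[OF U(1)]])
  have hn: "smooth_near \<A> p (\<lambda>q. h b (\<phi> q))" for b
    using smooth_nearI[OF N] smooth_fun_on_chart_compose[OF U(1) S(1) h(1)] unfolding N_def by blast
  have xc: "smooth_near \<A> p (\<lambda>q. \<phi> q \<bullet> b + - (\<phi> p \<bullet> b))" for b
    by (rule smooth_near_add[OF x smooth_near_const])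
  have "v f = v (\<lambda>q. f p + (\<Sum>b\<in>Basis. (\<phi> q \<bullet> b + - (\<phi> p \<bullet> b)) * h b (\<phi> q)))"
  proof (rule tangent_local[OF f N])
    fix q assume "q \<in> N"
    then show "f q = f p + (\<Sum>b\<in>Basis. (\<phi> q \<bullet> b + - (\<phi> p \<bullet> b)) * h b (\<phi> q))"
      using h(2)[of "\<phi> q"] chart_inv[OF U(1)] U(2) by (simp add: N_def inner_diff_left)
  qed
  also have "\<dots> = (\<Sum>b\<in>Basis. v (\<lambda>q. (\<phi> q \<bullet> b + - (\<phi> p \<bullet> b)) * h b (\<phi> q)))"
    by (simp only: tangent_add tangent_sum smooth_near_const smooth_near_sum smooth_near_mult xc hn
        tangent_const)
  also have "\<dots> = (\<Sum>b\<in>Basis. v (\<lambda>q. \<phi> q \<bullet> b) * h b (\<phi> p))"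
    by (intro sum.cong refl)
      (simp only: tangent_mult[OF xc hn] tangent_add[OF x smooth_near_const] tangent_const, simp)
  finally show ?thesis
    using h(3) by simp
qed

end

lemma tangent_eqI:
  assumes "v \<in> tangent_space \<A> p" "w \<in> tangent_space \<A> p" "(U, \<phi>) \<in> \<A>" "p \<in> U"
    and "\<And>b. b \<in> Basis \<Longrightarrow> v (\<lambda>q. \<phi> q \<bullet> b) = w (\<lambda>q. \<phi> q \<bullet> b)"
  shows "v = w"
proof
  fix f
  show "v f = w f"
  proof (cases "smooth_near \<A> p f")
    case True
    then show ?thesis
      using tangent_in_chart[OF assms(1,3,4)] tangent_in_chart[OF assms(2,3,4)] assms(5) by simp
  next
    \<comment> \<open>On functions not smooth near p both vectors are 0 by convention.\<close>
    case False
    then show ?thesis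
      using tangent_not_smooth assms(1,2) by metis
  qed
qed

lemma tangent_space_add: "v \<in> tangent_space \<A> p \<Longrightarrow> w \<in> tangent_space \<A> p \<Longrightarrow> v + w \<in> tangent_space \<A> p"
  unfolding tangent_space_def by (auto simp: algebra_simps)

lemma tangent_space_scale: "v \<in> tangent_space \<A> p \<Longrightarrow> (\<lambda>f. c * v f) \<in> tangent_space \<A> p"
  unfolding tangent_space_def by (auto simp: algebra_simps)

section \<open>The module of vector fields\<close>

lemma vector_field_tangent: "X \<in> vector_fields \<A> \<Longrightarrow> X p \<in> tangent_space \<A> p"
  unfolding vector_fields_def by blast

lemma vector_field_smooth:
  "X \<in> vector_fields \<A> \<Longrightarrow> open W \<Longrightarrow> smooth_fun_on \<A> W f \<Longrightarrow> smooth_fun_on \<A> W (deriv_along X f)"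
  unfolding vector_fields_def by blast

lemma vector_fields_add:
  assumes "X \<in> vector_fields \<A>" "Y \<in> vector_fields \<A>"
  shows "X + Y \<in> vector_fields \<A>"
proof -
  have "deriv_along (X + Y) f = (\<lambda>q. deriv_along X f q + deriv_along Y f q)" for f
    by (simp add: deriv_along_def fun_eq_iff)
  then show ?thesis
    using assms unfolding vector_fields_def by (auto intro: tangent_space_add smooth_fun_on_add)
qed

lemma vector_fields_scale:
  assumes "X \<in> vector_fields \<A>" "smooth_fun_on \<A> UNIV h"
  shows "fun_scale h X \<in> vector_fields \<A>"
proof -
  have "deriv_along (fun_scale h X) f = (\<lambda>q. h q * deriv_along X f q)" for f
    by (simp add: deriv_along_def fun_scale_def fun_eq_iff)
  moreover have "fun_scale h X p \<in> tangent_space \<A> p" for p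
    using tangent_space_scale[OF vector_field_tangent[OF assms(1)]] by (simp add: fun_scale_def)
  ultimately show ?thesis
    using assms smooth_fun_on_mono[OF assms(2)] unfolding vector_fields_def
    by (auto intro!: smooth_fun_on_mult)
qed

lemma vector_fields_diff:
  assumes "X \<in> vector_fields \<A>" "Y \<in> vector_fields \<A>"
  shows "X - Y \<in> vector_fields \<A>"
proof -
  have "X - Y = X + fun_scale (\<lambda>_. - 1) Y"
    by (simp add: fun_scale_def fun_eq_iff)
  then show ?thesis
    using vector_fields_add vector_fields_scale assms smooth_fun_on_const by metis
qed

end


section \<open>Orthogonal frames and tensoriality of the curvature derivative\<close>

lemma sum_fun_apply: "(\<Sum>i\<in>I. F i) x = (\<Sum>i\<in>I. F i x)"
  by (induction I rule: infinite_finite_induct) auto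

lemma fun_scale_apply: "fun_scale h X p f = h p * X p f"
  by (simp add: fun_scale_def)

locale metric_manifold = smooth_manifold \<A>
  for \<A> :: "('a::topological_space, 'e::euclidean_space) atlas" +
  fixes g :: "'a metric_tensor"
  assumes metric: "pseudo_riemannian_metric \<A> g"
begin

lemmas metric_sym = metric[unfolded pseudo_riemannian_metric_def, THEN conjunct1, rule_format]
  and metric_add_left =
    metric[unfolded pseudo_riemannian_metric_def, THEN conjunct2, THEN conjunct1, rule_format]
  and metric_scale_left =
    metric[unfolded pseudo_riemannian_metric_def, THEN conjunct2, THEN conjunct2, THEN conjunct1,
      rule_format]

lemma metric_smooth:
  "X \<in> vector_fields \<A> \<Longrightarrow> Y \<in> vector_fields \<A> \<Longrightarrow> smooth_fun_on \<A> UNIV (inner_fields g X Y)"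
  using metric unfolding pseudo_riemannian_metric_def by blast

lemma tangent_space_zero: "0 \<in> tangent_space \<A> p"
  unfolding tangent_space_def by simp

lemma tangent_space_sum:
  "(\<And>i. i \<in> I \<Longrightarrow> v i \<in> tangent_space \<A> p) \<Longrightarrow> (\<Sum>i\<in>I. v i) \<in> tangent_space \<A> p"
  by (induction I rule: infinite_finite_induct) (auto intro: tangent_space_add tangent_space_zero)

lemma metric_zero_left: "w \<in> tangent_space \<A> p \<Longrightarrow> g p 0 w = 0"
  using metric_scale_left[OF tangent_space_zero, of w p 0] by (simp add: zero_fun_def)

lemma metric_sum_left:
  assumes "\<And>i. i \<in> I \<Longrightarrow> v i \<in> tangent_space \<A> p" "w \<in> tangent_space \<A> p"
  shows "g p (\<Sum>i\<in>I. v i) w = (\<Sum>i\<in>I. g p (v i) w)"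
  using assms(1)
  by (induction I rule: infinite_finite_induct)
    (simp_all add: metric_zero_left metric_add_left tangent_space_sum assms(2))

end

locale orthogonal_frame = metric_manifold \<A> g
  for \<A> :: "('a::topological_space, 'e::euclidean_space) atlas" and g +
  fixes E :: "'n::finite \<Rightarrow> 'a vector_field" and \<gamma> :: "'n \<Rightarrow> real"
  assumes dim: "DIM('e) = CARD('n)"
    and frame_field: "E i \<in> vector_fields \<A>"
    and frame_inner: "g p (E i p) (E j p) = (if i = j then \<gamma> i else 0)"
    and frame_nonzero: "\<gamma> i \<noteq> 0"
begin

section \<open>Expansion in an orthogonal frame\<close>

lemma frame_combination_tangent: "(\<lambda>f. \<Sum>i\<in>UNIV. a i * E i p f) \<in> tangent_space \<A> p"
proof -
  have "(\<lambda>f. \<Sum>i\<in>UNIV. a i * E i p f) = (\<Sum>i\<in>UNIV. (\<lambda>f. a i * E i p f))"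
    by (simp add: sum_fun_apply fun_eq_iff)
  then show ?thesis
    by (simp add: tangent_space_sum tangent_space_scale vector_field_tangent frame_field)
qed

lemma frame_combination_inner: "g p (\<lambda>f. \<Sum>i\<in>UNIV. a i * E i p f) (E j p) = a j * \<gamma> j"
proof -
  have "(\<lambda>f. \<Sum>i\<in>UNIV. a i * E i p f) = (\<Sum>i\<in>UNIV. (\<lambda>f. a i * E i p f))"
    by (simp add: sum_fun_apply fun_eq_iff)
  then have "g p (\<lambda>f. \<Sum>i\<in>UNIV. a i * E i p f) (E j p) = (\<Sum>i\<in>UNIV. a i * g p (E i p) (E j p))"
    by (simp add: metric_sum_left metric_scale_left tangent_space_scale vector_field_tangent frame_field)
  also have "\<dots> = (\<Sum>i\<in>UNIV. if i = j then a i * \<gamma> i else 0)"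
    by (intro sum.cong) (auto simp: frame_inner)
  finally show ?thesis by simp
qed

text \<open>The frame consists of as many independent vectors as a tangent vector has chart coordinates.\<close>

lemma frame_span:
  assumes v: "v \<in> tangent_space \<A> p"
  obtains a where "v = (\<lambda>f. \<Sum>i\<in>UNIV. a i * E i p f)"
proof -
  obtain U \<phi> where U: "(U, \<phi>) \<in> \<A>" "p \<in> U"
    by (rule chart_exists)
  \<comment> \<open>Tangent vectors are functions without an ambient vector space type, so
    dimensions are counted in the model space: \<open>K\<close> collects the values on chart
    coordinates and is injective on tangent vectors by \<open>tangent_eqI\<close>.\<close>
  define K :: "'a tangent \<Rightarrow> 'e" where "K w = (\<Sum>b\<in>Basis. w (\<lambda>q. \<phi> q \<bullet> b) *\<^sub>R b)" for w
  define T :: "real ^ 'n \<Rightarrow> 'e" where "T a = K (\<lambda>f. \<Sum>i\<in>UNIV. a $ i * E i p f)" for a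
  have K: "w = w'" if "K w = K w'" "w \<in> tangent_space \<A> p" "w' \<in> tangent_space \<A> p" for w w'
  proof (rule tangent_eqI[OF that(2,3) U])
    fix b :: 'e assume b: "b \<in> Basis"
    have "K u \<bullet> b = u (\<lambda>q. \<phi> q \<bullet> b)" for u
      by (simp add: K_def b)
    then show "w (\<lambda>q. \<phi> q \<bullet> b) = w' (\<lambda>q. \<phi> q \<bullet> b)"
      using that(1) by metis
  qed
  have lin: "linear T"
    by (rule linearI)
      (simp_all add: T_def K_def sum.distrib scaleR_sum_right sum_distrib_left algebra_simps)
  have "inj T"
  proof (rule injI)
    fix a b assume "T a = T b"
    then have eq: "(\<lambda>f. \<Sum>i\<in>UNIV. a $ i * E i p f) = (\<lambda>f. \<Sum>i\<in>UNIV. b $ i * E i p f)"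
      unfolding T_def by (rule K) (rule frame_combination_tangent)+
    have "a $ j * \<gamma> j = b $ j * \<gamma> j" for j
      unfolding frame_combination_inner[of p "\<lambda>i. a $ i", symmetric]
        frame_combination_inner[of p "\<lambda>i. b $ i", symmetric] eq ..
    then show "a = b"
      using frame_nonzero by (simp add: vec_eq_iff)
  qed
  then have "dim (range T) = dim (UNIV :: (real ^ 'n) set)"
    using dim_image_eq[OF lin] by (simp add: inj_on_subset)
  then have "span (range T) = UNIV"
    using dim dim_eq_full[of "range T"] by simp
  moreover have "span (range T) = range T"
    by (simp add: linear_subspace_image[OF lin subspace_UNIV])
  ultimately have "surj T"
    by simp
  then obtain a where "K v = T a"
    by blast
  then have "v = (\<lambda>f. \<Sum>i\<in>UNIV. a $ i * E i p f)"
    unfolding T_def by (rule K) (rule v, rule frame_combination_tangent)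
  then show thesis
    by (rule that)
qed

lemma frame_eqI:
  assumes "v \<in> tangent_space \<A> p" "w \<in> tangent_space \<A> p"
    and "\<And>j. g p v (E j p) = g p w (E j p)"
  shows "v = w"
proof -
  obtain a where a: "v = (\<lambda>f. \<Sum>i\<in>UNIV. a i * E i p f)"
    by (rule frame_span[OF assms(1)])
  obtain b where b: "w = (\<lambda>f. \<Sum>i\<in>UNIV. b i * E i p f)"
    by (rule frame_span[OF assms(2)])
  have "a j * \<gamma> j = b j * \<gamma> j" for j
    using assms(3)[of j] frame_combination_inner unfolding a b by simp
  then show ?thesis
    using frame_nonzero by (simp add: a b)
qed

text \<open>The coefficients g(X, E i) / \<gamma> i are smooth on the whole manifold, because the
  metric sends smooth fields to smooth functions and \<gamma> is constant.\<close>

lemma frame_expansion: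
  assumes X: "X \<in> vector_fields \<A>"
  obtains x where "\<And>i. smooth_fun_on \<A> UNIV (x i)" "X = (\<Sum>i\<in>UNIV. fun_scale (x i) (E i))"
proof
  let ?x = "\<lambda>i p. inner_fields g X (E i) p * (1 / \<gamma> i)"
  show "smooth_fun_on \<A> UNIV (?x i)" for i
    by (intro smooth_fun_on_mult metric_smooth X frame_field smooth_fun_on_const) simp
  show "X = (\<Sum>i\<in>UNIV. fun_scale (?x i) (E i))"
  proof
    fix p
    have "X p = (\<lambda>f. \<Sum>i\<in>UNIV. ?x i p * E i p f)"
    proof (rule frame_eqI[OF vector_field_tangent[OF X] frame_combination_tangent])
      show "g p (X p) (E j p) = g p (\<lambda>f. \<Sum>i\<in>UNIV. ?x i p * E i p f) (E j p)" for j
        unfolding frame_combination_inner[where a = "\<lambda>i. ?x i p"]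
        by (simp add: inner_fields_def frame_nonzero)
    qed
    then show "X p = (\<Sum>i\<in>UNIV. fun_scale (?x i) (E i)) p"
      by (simp add: sum_fun_apply fun_scale_def fun_eq_iff)
  qed
qed

section \<open>Function-linear operators on vector fields\<close>

lemma zero_field: "0 \<in> vector_fields \<A>"
  using vector_fields_diff[OF frame_field frame_field] by (metis diff_self)

lemma sum_fields: "(\<And>i. i \<in> I \<Longrightarrow> X i \<in> vector_fields \<A>) \<Longrightarrow> (\<Sum>i\<in>I. X i) \<in> vector_fields \<A>"
  by (induction I rule: infinite_finite_induct) (auto intro: zero_field vector_fields_add)

text \<open>Multipliers are smooth everywhere; as \<open>frame_expansion\<close> yields global
  coefficients, such a map is already determined by its values on the frame.\<close>

definition tensorial :: "('a vector_field \<Rightarrow> 'a vector_field) \<Rightarrow> bool" where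
  "tensorial P \<longleftrightarrow>
     (\<forall>X\<in>vector_fields \<A>. \<forall>Y\<in>vector_fields \<A>. P (X + Y) = P X + P Y) \<and>
     (\<forall>X\<in>vector_fields \<A>. \<forall>h. smooth_fun_on \<A> UNIV h \<longrightarrow> P (fun_scale h X) = fun_scale h (P X))"

lemma tensorial_eq_0:
  assumes P: "tensorial P" and 0: "\<And>i. P (E i) = 0" and X: "X \<in> vector_fields \<A>"
  shows "P X = 0"
proof -
  obtain x where x: "\<And>i. smooth_fun_on \<A> UNIV (x i)" "X = (\<Sum>i\<in>UNIV. fun_scale (x i) (E i))"
    using frame_expansion[OF X] by blast
  have Pi: "P (fun_scale (x i) (E i)) = 0" for i
    using P x(1) frame_field 0 unfolding tensorial_def by (simp add: fun_scale_def fun_eq_iff)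
  have add: "P (X + Y) = P X + P Y" if "X \<in> vector_fields \<A>" "Y \<in> vector_fields \<A>" for X Y
    using P that unfolding tensorial_def by blast
  have P0: "P 0 = 0"
    using add[OF zero_field zero_field] by simp
  have "P (\<Sum>i\<in>I. fun_scale (x i) (E i)) = 0" for I
  proof (induction I rule: infinite_finite_induct)
    case (insert i I)
    have "P (\<Sum>i\<in>insert i I. fun_scale (x i) (E i))
        = P (fun_scale (x i) (E i)) + P (\<Sum>i\<in>I. fun_scale (x i) (E i))"
      unfolding sum.insert[OF insert(1,2)]
      by (intro add sum_fields vector_fields_scale frame_field x(1))
    then show ?case
      by (simp only: Pi insert add_0)
  next
    case empty
    show ?case
      by (simp only: sum.empty P0)
  next
    case (infinite I)
    then show ?case
      by (simp only: sum.infinite P0 simp_thms)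
  qed
  then show ?thesis
    using x(2) by simp
qed

end

locale levi_civita = orthogonal_frame \<A> g E \<gamma>
  for \<A> :: "('a::topological_space, 'e::euclidean_space) atlas" and g
    and E :: "'n::finite \<Rightarrow> 'a vector_field" and \<gamma> +
  fixes D :: "'a connection"
  assumes connection: "levi_civita_connection \<A> g D"
begin

section \<open>Algebra of the connection and its curvature\<close>

lemma affine: "affine_connection \<A> D"
  using connection unfolding levi_civita_connection_def by blast

lemma connection_field: "X \<in> vector_fields \<A> \<Longrightarrow> Y \<in> vector_fields \<A> \<Longrightarrow> D X Y \<in> vector_fields \<A>"
  using affine unfolding affine_connection_def by blast

lemma connection_add:
  assumes "X \<in> vector_fields \<A>" "Y \<in> vector_fields \<A>" "Z \<in> vector_fields \<A>"
  shows "D (X + Y) Z = D X Z + D Y Z" "D X (Y + Z) = D X Y + D X Z"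
  using affine assms unfolding affine_connection_def by blast+

lemma connection_scale:
  assumes "smooth_fun_on \<A> UNIV h" "X \<in> vector_fields \<A>" "Y \<in> vector_fields \<A>"
  shows "D (fun_scale h X) Y = fun_scale h (D X Y)"
    and "D X (fun_scale h Y) = fun_scale (deriv_along X h) Y + fun_scale h (D X Y)"
  using affine assms unfolding affine_connection_def by blast+

lemma connection_diff:
  assumes "X \<in> vector_fields \<A>" "Y \<in> vector_fields \<A>" "Z \<in> vector_fields \<A>"
  shows "D (X - Y) Z = D X Z - D Y Z" "D X (Y - Z) = D X Y - D X Z"
  using connection_add(1)[OF vector_fields_diff[OF assms(1,2)] assms(2,3)]
    connection_add(2)[OF assms(1) vector_fields_diff[OF assms(2,3)] assms(3)]
  by (simp_all add: eq_diff_eq)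

text \<open>Oriented to rewrite the bracket away: curvature then involves D alone, and closure of
  the vector fields under brackets is inherited from D.\<close>

lemma torsion_free:
  "X \<in> vector_fields \<A> \<Longrightarrow> Y \<in> vector_fields \<A> \<Longrightarrow> lie_bracket \<A> X Y = D X Y - D Y X"
  using connection unfolding levi_civita_connection_def by metis

lemma deriv_along_smooth:
  "X \<in> vector_fields \<A> \<Longrightarrow> smooth_fun_on \<A> UNIV h \<Longrightarrow> smooth_fun_on \<A> UNIV (deriv_along X h)"
  using vector_field_smooth open_UNIV by blast

lemmas connection_rules = connection_field connection_add connection_scale connection_diff
  vector_fields_add vector_fields_diff vector_fields_scale deriv_along_smooth

text \<open>Torsion-freeness evaluated on h. It cancels the second derivatives of h that appear when
  R(X,Y) is applied to h Z.\<close>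

lemma deriv_along_commutator:
  assumes "X \<in> vector_fields \<A>" "Y \<in> vector_fields \<A>" "smooth_fun_on \<A> UNIV h"
  shows "deriv_along (D X Y) h p - deriv_along (D Y X) h p
    = deriv_along X (deriv_along Y h) p - deriv_along Y (deriv_along X h) p"
proof -
  have "smooth_near \<A> p h"
    using smooth_nearI[OF open_UNIV UNIV_I assms(3)] .
  then have "lie_bracket \<A> X Y p h = X p (deriv_along Y h) - Y p (deriv_along X h)"
    by (simp add: lie_bracket_def)
  then show ?thesis
    unfolding torsion_free[OF assms(1,2)] by (simp add: deriv_along_def)
qed

lemma curvature_eq:
  assumes "X \<in> vector_fields \<A>" "Y \<in> vector_fields \<A>" "Z \<in> vector_fields \<A>"
  shows "curvature \<A> D X Y Z = D X (D Y Z) - D Y (D X Z) - (D (D X Y) Z - D (D Y X) Z)"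
  using assms by (simp add: curvature_def torsion_free connection_rules)

lemma curvature_field:
  "X \<in> vector_fields \<A> \<Longrightarrow> Y \<in> vector_fields \<A> \<Longrightarrow> Z \<in> vector_fields \<A> \<Longrightarrow>
    curvature \<A> D X Y Z \<in> vector_fields \<A>"
  by (simp add: curvature_eq connection_rules)

lemma curvature_add:
  assumes "X \<in> vector_fields \<A>" "X' \<in> vector_fields \<A>" "Y \<in> vector_fields \<A>" "Z \<in> vector_fields \<A>"
  shows "curvature \<A> D (X + X') Y Z = curvature \<A> D X Y Z + curvature \<A> D X' Y Z"
    and "curvature \<A> D Y (X + X') Z = curvature \<A> D Y X Z + curvature \<A> D Y X' Z"
    and "curvature \<A> D Y Z (X + X') = curvature \<A> D Y Z X + curvature \<A> D Y Z X'"
  using assms by (simp_all add: curvature_eq connection_rules)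

lemma curvature_scale:
  assumes "smooth_fun_on \<A> UNIV h"
    and "X \<in> vector_fields \<A>" "Y \<in> vector_fields \<A>" "Z \<in> vector_fields \<A>"
  shows "curvature \<A> D (fun_scale h X) Y Z = fun_scale h (curvature \<A> D X Y Z)"
    and "curvature \<A> D X (fun_scale h Y) Z = fun_scale h (curvature \<A> D X Y Z)"
    and "curvature \<A> D X Y (fun_scale h Z) = fun_scale h (curvature \<A> D X Y Z)"
proof -
  show "curvature \<A> D (fun_scale h X) Y Z = fun_scale h (curvature \<A> D X Y Z)"
    using assms by (simp add: curvature_eq connection_rules) (simp add: fun_eq_iff fun_scale_apply algebra_simps)
  show "curvature \<A> D X (fun_scale h Y) Z = fun_scale h (curvature \<A> D X Y Z)"
    using assms by (simp add: curvature_eq connection_rules) (simp add: fun_eq_iff fun_scale_apply algebra_simps)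
  show "curvature \<A> D X Y (fun_scale h Z) = fun_scale h (curvature \<A> D X Y Z)"
  proof (intro ext)
    fix p f
    \<comment> \<open>The expansion leaves Z with the coefficient X (Y h) - Y (X h) minus the
      derivative of h along D X Y - D Y X, which is zero.\<close>
    have "deriv_along (D X Y) h p * Z p f - deriv_along (D Y X) h p * Z p f
        = (deriv_along X (deriv_along Y h) p - deriv_along Y (deriv_along X h) p) * Z p f"
      unfolding deriv_along_commutator[OF assms(2,3,1), symmetric] by (simp add: algebra_simps)
    then show "curvature \<A> D X Y (fun_scale h Z) p f = fun_scale h (curvature \<A> D X Y Z) p f"
      using assms by (simp add: curvature_eq connection_rules) (simp add: fun_scale_apply algebra_simps)
  qed
qed

text \<open>In the first slot no derivative of h arises. In each other slot the product rule
  produces the derivative of h times the curvature twice with opposite signs: once from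
  differentiating the curvature, once from the slot itself.\<close>

lemma nabla_curvature_tensorial:
  assumes "X \<in> vector_fields \<A>" "Y \<in> vector_fields \<A>" "Z \<in> vector_fields \<A>"
  shows "tensorial (\<lambda>W. nabla_curvature \<A> D W X Y Z)"
    and "tensorial (\<lambda>W. nabla_curvature \<A> D X W Y Z)"
    and "tensorial (\<lambda>W. nabla_curvature \<A> D X Y W Z)"
    and "tensorial (\<lambda>W. nabla_curvature \<A> D X Y Z W)"
  using assms
  by (simp_all add: tensorial_def nabla_curvature_def curvature_add curvature_scale curvature_field connection_rules)
    (simp_all add: fun_eq_iff fun_scale_apply algebra_simps)

lemma nabla_curvature_eq_0:
  assumes "\<And>w x y z. nabla_curvature \<A> D (E w) (E x) (E y) (E z) = 0"
    and "W \<in> vector_fields \<A>" "X \<in> vector_fields \<A>" "Y \<in> vector_fields \<A>" "Z \<in> vector_fields \<A>"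
  shows "nabla_curvature \<A> D W X Y Z = 0"
proof -
  note t = nabla_curvature_tensorial[THEN tensorial_eq_0]
  \<comment> \<open>Slots are freed from last to first, so that each use of tensoriality already has
    arbitrary fields in the later slots.\<close>
  have "nabla_curvature \<A> D (E w) (E x) (E y) Z = 0" for w x y
    by (rule t(4)) (use assms frame_field in auto)
  then have "nabla_curvature \<A> D (E w) (E x) Y Z = 0" for w x
    by (rule t(3)[rotated 3]) (use assms frame_field in auto)
  then have "nabla_curvature \<A> D (E w) X Y Z = 0" for w
    by (rule t(2)[rotated 3]) (use assms frame_field in auto)
  then show ?thesis
    by (rule t(1)[rotated 3]) (use assms frame_field in auto)
qed

section \<open>The Koszul formula on the frame\<close>

lemma inner_frame_antisym: "g p (D (E i) (E j) p) (E k p) = - g p (D (E i) (E k) p) (E j p)"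
proof -
  have "deriv_along (E i) (inner_fields g (E j) (E k)) p
      = inner_fields g (D (E i) (E j)) (E k) p + inner_fields g (E j) (D (E i) (E k)) p"
    using connection frame_field unfolding levi_civita_connection_def by (simp add: plus_fun_def)
  moreover have "deriv_along (E i) (inner_fields g (E j) (E k)) p = 0"
    unfolding deriv_along_def inner_fields_def frame_inner
    by (rule tangent_const[OF vector_field_tangent[OF frame_field]])
  moreover have "g p (E j p) (D (E i) (E k) p) = g p (D (E i) (E k) p) (E j p)"
    by (intro metric_sym vector_field_tangent connection_field frame_field)
  ultimately show ?thesis
    by (simp add: inner_fields_def)
qed

text \<open>The inner products of the frame are constant, so metric compatibility reduces to the
  antisymmetry above and no derivative terms occur. Torsion-freeness turns the three brackets into
  six terms; antisymmetry makes two of them equal and cancels the other four.\<close>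

lemma koszul:
  "2 * g p (D (E i) (E j) p) (E k p) = g p (lie_bracket \<A> (E i) (E j) p) (E k p)
     - g p (lie_bracket \<A> (E j) (E k) p) (E i p) + g p (lie_bracket \<A> (E k) (E i) p) (E j p)"
proof -
  have "g p (lie_bracket \<A> (E a) (E b) p) (E c p)
      = g p (D (E a) (E b) p) (E c p) - g p (D (E b) (E a) p) (E c p)" for a b c
  proof -
    have "D (E a) (E b) p = D (E b) (E a) p + lie_bracket \<A> (E a) (E b) p"
      by (simp add: torsion_free frame_field)
    moreover have "lie_bracket \<A> (E a) (E b) \<in> vector_fields \<A>"
      by (simp add: torsion_free frame_field connection_field vector_fields_diff)
    ultimately have "g p (D (E a) (E b) p) (E c p)
        = g p (D (E b) (E a) p) (E c p) + g p (lie_bracket \<A> (E a) (E b) p) (E c p)"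
      by (metis metric_add_left vector_field_tangent frame_field connection_field)
    then show ?thesis by simp
  qed
  then show ?thesis
    using inner_frame_antisym[of p i j k] inner_frame_antisym[of p j i k] inner_frame_antisym[of p k i j]
    by simp
qed

end


section \<open>Frames with integral structure constants\<close>

text \<open>A list of pairs \<open>(a, i)\<close> encodes the linear combination of the \<open>E i\<close> with coefficients \<open>a\<close>.\<close>

definition coefficient :: "(int \<times> 'n) list \<Rightarrow> 'n \<Rightarrow> int" where
  "coefficient xs k = (\<Sum>(a, i)\<leftarrow>xs. if i = k then a else 0)"

definition negate :: "(int \<times> 'n) list \<Rightarrow> (int \<times> 'n) list" where
  "negate xs = map (\<lambda>(a, i). (- a, i)) xs"

definition expand :: "(int \<times> 'm) list \<Rightarrow> ('m \<Rightarrow> (int \<times> 'n) list) \<Rightarrow> (int \<times> 'n) list" where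
  "expand xs c = concat (map (\<lambda>(a, i). map (\<lambda>(b, j). (a * b, j)) (c i)) xs)"

text \<open>Testing just the indices that occur keeps the check executable without enumerating the
  index type; every other index has coefficient 0 trivially.\<close>

definition vanishes :: "(int \<times> 'n) list \<Rightarrow> bool" where
  "vanishes xs \<longleftrightarrow> (\<forall>(a, k)\<in>set xs. coefficient xs k = 0)"

definition lincomb :: "(int \<times> 'n) list \<Rightarrow> ('n \<Rightarrow> 'a vector_field) \<Rightarrow> 'a vector_field" where
  "lincomb xs F = (\<lambda>p f. \<Sum>(a, i)\<leftarrow>xs. of_int a * F i p f)"

text \<open>Coefficients of the operator R(E i, E j) = [D (E i), D (E j)] - D [E i, E j] with
  respect to the operators D (E k).\<close>

definition frame_curvature :: "('n \<Rightarrow> 'n \<Rightarrow> (int \<times> 'n) list) \<Rightarrow> ('n \<Rightarrow> 'n \<Rightarrow> (int \<times> 'n) list) \<Rightarrow>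
    'n \<Rightarrow> 'n \<Rightarrow> (int \<times> 'n) list" where
  "frame_curvature br c i j = c i j @ negate (br i j)"

lemma lincomb_Nil: "lincomb [] F = 0"
  and lincomb_Cons: "lincomb ((a, i) # xs) F = fun_scale (\<lambda>_. of_int a) (F i) + lincomb xs F"
  by (simp_all add: lincomb_def fun_scale_def fun_eq_iff)

lemma lincomb_append: "lincomb (xs @ ys) F = lincomb xs F + lincomb ys F"
  by (simp add: lincomb_def fun_eq_iff)

lemma lincomb_negate: "lincomb (negate xs) F = - lincomb xs F"
  unfolding negate_def by (induction xs) (auto simp: lincomb_Nil lincomb_Cons fun_eq_iff fun_scale_apply)

lemma lincomb_scaled:
  "lincomb (map (\<lambda>(b, j). (a * b, j)) xs) F = fun_scale (\<lambda>_. of_int a) (lincomb xs F)"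
  by (induction xs) (auto simp: lincomb_Nil lincomb_Cons fun_eq_iff fun_scale_apply algebra_simps)

lemma lincomb_expand: "lincomb (expand xs c) F = lincomb xs (\<lambda>i. lincomb (c i) F)"
  unfolding expand_def
  by (induction xs)
    (auto simp: lincomb_Nil lincomb_Cons lincomb_append lincomb_scaled fun_eq_iff)

lemma lincomb_diff: "lincomb xs (\<lambda>i. F i - G i) = lincomb xs F - lincomb xs G"
  by (induction xs) (auto simp: lincomb_Nil lincomb_Cons fun_eq_iff fun_scale_apply algebra_simps)

lemma lincomb_scale: "lincomb xs (\<lambda>i. fun_scale h (F i)) = fun_scale h (lincomb xs F)"
  by (induction xs) (auto simp: lincomb_Nil lincomb_Cons fun_eq_iff fun_scale_apply algebra_simps)

lemma lincomb_add: "lincomb xs (\<lambda>i. F i + G i) = lincomb xs F + lincomb xs G"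
  by (induction xs) (auto simp: lincomb_Nil lincomb_Cons fun_eq_iff fun_scale_apply algebra_simps)

lemma lincomb_0: "lincomb xs (\<lambda>i. 0) = 0"
  by (induction xs) (auto simp: lincomb_Nil lincomb_Cons fun_eq_iff fun_scale_apply)

lemma lincomb_swap: "lincomb xs (\<lambda>i. lincomb ys (\<lambda>j. F i j)) = lincomb ys (\<lambda>j. lincomb xs (\<lambda>i. F i j))"
proof (induction xs)
  case Nil
  show ?case by (simp only: lincomb_Nil lincomb_0)
next
  case (Cons x xs)
  then show ?case
    by (cases x) (simp only: lincomb_Cons lincomb_add lincomb_scale)
qed

lemma lincomb_coefficient:
  fixes F :: "'n::finite \<Rightarrow> 'a vector_field"
  shows "lincomb xs F p f = (\<Sum>k\<in>UNIV. of_int (coefficient xs k) * F k p f)"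
proof (induction xs)
  case Nil
  then show ?case by (simp add: lincomb_def coefficient_def)
next
  case (Cons x xs)
  obtain a i where x: "x = (a, i)" by fastforce
  have "lincomb (x # xs) F p f = of_int a * F i p f + lincomb xs F p f"
    by (simp add: x lincomb_Cons fun_scale_apply)
  also have "\<dots> = (\<Sum>k\<in>UNIV. if i = k then of_int a * F k p f else 0)
      + (\<Sum>k\<in>UNIV. of_int (coefficient xs k) * F k p f)"
    unfolding Cons by simp
  also have "\<dots> = (\<Sum>k\<in>UNIV. of_int (coefficient (x # xs) k) * F k p f)"
    unfolding sum.distrib[symmetric] by (rule sum.cong) (auto simp: coefficient_def x algebra_simps)
  finally show ?case .
qed

lemma lincomb_vanishes:
  fixes F :: "'n::finite \<Rightarrow> 'a vector_field"
  assumes "vanishes xs"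
  shows "lincomb xs F = 0"
proof -
  have "coefficient xs k = 0" for k
  proof (cases "k \<in> snd ` set xs")
    case True
    then show ?thesis using assms by (auto simp: vanishes_def)
  next
    case False
    then show ?thesis
      unfolding coefficient_def by (induction xs) auto
  qed
  then show ?thesis
    by (simp add: fun_eq_iff lincomb_coefficient)
qed

section \<open>Real-linear operators on integral combinations\<close>

context levi_civita
begin

text \<open>Linearity over constants: \<open>D X\<close> is not function-linear in its second
  argument, but X annihilates constants, which is enough for integral combinations.\<close>

definition real_linear :: "('a vector_field \<Rightarrow> 'a vector_field) \<Rightarrow> bool" where
  "real_linear P \<longleftrightarrow>
     (\<forall>X\<in>vector_fields \<A>. \<forall>Y\<in>vector_fields \<A>. P (X + Y) = P X + P Y) \<and>
     (\<forall>X\<in>vector_fields \<A>. \<forall>a. P (fun_scale (\<lambda>_. a) X) = fun_scale (\<lambda>_. a) (P X))"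

lemma lincomb_field: "(\<And>i. F i \<in> vector_fields \<A>) \<Longrightarrow> lincomb xs F \<in> vector_fields \<A>"
  by (induction xs)
    (auto simp: lincomb_Nil lincomb_Cons
      intro!: zero_field vector_fields_add vector_fields_scale smooth_fun_on_const)

lemma real_linear_lincomb:
  assumes P: "real_linear P" and F: "\<And>i. F i \<in> vector_fields \<A>"
  shows "P (lincomb xs F) = lincomb xs (\<lambda>i. P (F i))"
proof (induction xs)
  case Nil
  have "P (0 + 0) = P 0 + P 0"
    using P zero_field unfolding real_linear_def by blast
  then have "P 0 = 0" by simp
  then show ?case by (simp only: lincomb_Nil)
next
  case (Cons x xs)
  obtain a i where x: "x = (a, i)" by fastforce
  have "P (fun_scale (\<lambda>_. of_int a) (F i) + lincomb xs F)
      = P (fun_scale (\<lambda>_. of_int a) (F i)) + P (lincomb xs F)"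
    by (rule P[unfolded real_linear_def, THEN conjunct1, rule_format])
      (intro vector_fields_scale smooth_fun_on_const lincomb_field F)+
  also have "P (fun_scale (\<lambda>_. of_int a) (F i)) = fun_scale (\<lambda>_. of_int a) (P (F i))"
    using P F unfolding real_linear_def by blast
  finally show ?case
    by (simp only: x lincomb_Cons Cons)
qed

lemma real_linear_connection:
  assumes "X \<in> vector_fields \<A>"
  shows "real_linear (D X)" "real_linear (\<lambda>Y. D Y X)"
proof -
  have "deriv_along X (\<lambda>_. a) p = 0" for a p
    unfolding deriv_along_def by (rule tangent_const[OF vector_field_tangent[OF assms]])
  then show "real_linear (D X)"
    using assms unfolding real_linear_def
    by (simp add: connection_add connection_scale smooth_fun_on_const)
      (simp add: fun_eq_iff fun_scale_apply)
  show "real_linear (\<lambda>Y. D Y X)"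
    using assms unfolding real_linear_def
    by (simp add: connection_add connection_scale smooth_fun_on_const)
qed

lemma real_linear_curvature:
  assumes "X \<in> vector_fields \<A>" "Y \<in> vector_fields \<A>"
  shows "real_linear (\<lambda>Z. curvature \<A> D Z X Y)" "real_linear (\<lambda>Z. curvature \<A> D X Z Y)"
    "real_linear (\<lambda>Z. curvature \<A> D X Y Z)"
  using assms unfolding real_linear_def
  by (simp_all add: curvature_add curvature_scale smooth_fun_on_const)

lemma inner_lincomb: "g p (lincomb xs E p) (E k p) = of_int (coefficient xs k) * \<gamma> k"
proof -
  have "lincomb xs E p = (\<lambda>f. \<Sum>i\<in>UNIV. of_int (coefficient xs i) * E i p f)"
    by (simp add: fun_eq_iff lincomb_coefficient)
  then show ?thesis
    by (simp only: frame_combination_inner)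
qed

end

text \<open>The operators \<open>D (E i)\<close> span a Lie algebra with structure constants \<open>c\<close> on the span of the
  frame, so every \<open>R (E i) (E j)\<close> is a combination of them. This turns \<open>\<nabla>R = 0\<close> into an identity
  between coefficients.\<close>

locale closed_frame = levi_civita \<A> g E \<gamma> D
  for \<A> :: "('a::topological_space, 'e::euclidean_space) atlas" and g
    and E :: "'n::finite \<Rightarrow> 'a vector_field" and \<gamma> and D +
  fixes br \<Gamma> c :: "'n \<Rightarrow> 'n \<Rightarrow> (int \<times> 'n) list"
  assumes bracket: "lie_bracket \<A> (E i) (E j) = lincomb (br i j) E"
    and koszul_coefficients: "2 * \<gamma> k * coefficient (\<Gamma> i j) k = \<gamma> k * coefficient (br i j) k
      - \<gamma> i * coefficient (br j k) i + \<gamma> j * coefficient (br k i) j"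
    and commutators: "vanishes (expand (\<Gamma> j z) (\<Gamma> i) @ negate (expand (\<Gamma> i z) (\<Gamma> j))
      @ negate (expand (c i j) (\<lambda>k. \<Gamma> k z)))"
    and parallel: "vanishes (expand (frame_curvature br c x y) (c w)
      @ negate (expand (\<Gamma> w x) (\<lambda>i. frame_curvature br c i y))
      @ negate (expand (\<Gamma> w y) (frame_curvature br c x)))"
begin

section \<open>Connection, curvature and its derivative on the frame\<close>

abbreviation \<rho> :: "'n \<Rightarrow> 'n \<Rightarrow> (int \<times> 'n) list" where "\<rho> \<equiv> frame_curvature br c"

text \<open>A tangent vector is fixed by its inner products with the frame. The Koszul formula
  supplies those of \<open>D (E i) (E j)\<close>, and \<open>koszul_coefficients\<close> gives the
  table \<Gamma> the same ones; so \<Gamma> is verified, not computed.\<close>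

lemma connection_frame: "D (E i) (E j) = lincomb (\<Gamma> i j) E"
proof
  fix p
  show "D (E i) (E j) p = lincomb (\<Gamma> i j) E p"
  proof (rule frame_eqI)
    fix k
    have "2 * g p (D (E i) (E j) p) (E k p) = 2 * g p (lincomb (\<Gamma> i j) E p) (E k p)"
      unfolding koszul bracket inner_lincomb using koszul_coefficients[of k i j]
      by (simp add: mult_ac)
    then show "g p (D (E i) (E j) p) (E k p) = g p (lincomb (\<Gamma> i j) E p) (E k p)"
      by simp
  qed (intro vector_field_tangent connection_field lincomb_field frame_field)+
qed

lemma connection_left: "Z \<in> vector_fields \<A> \<Longrightarrow> D (lincomb xs E) Z = lincomb xs (\<lambda>i. D (E i) Z)"
  by (rule real_linear_lincomb[OF real_linear_connection(2)]) (simp_all add: frame_field)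

lemma connection_right:
  assumes "X \<in> vector_fields \<A>" "\<And>i. F i \<in> vector_fields \<A>"
  shows "D X (lincomb xs F) = lincomb xs (\<lambda>i. D X (F i))"
  by (rule real_linear_lincomb[OF real_linear_connection(1)[OF assms(1)] assms(2)])

text \<open>As \<Gamma> has constant entries, D (E i) acts on \<open>D (E j) (E z)\<close> by
  substitution, so \<open>expand (\<Gamma> j z) (\<Gamma> i)\<close> encodes the second
  derivative.\<close>

lemma connection_commutator:
  "D (E i) (D (E j) (E z)) - D (E j) (D (E i) (E z)) = lincomb (c i j) (\<lambda>k. D (E k) (E z))"
  using lincomb_vanishes[OF commutators[of j z i], of E]
  by (simp add: lincomb_append lincomb_negate lincomb_expand connection_frame connection_right
      frame_field algebra_simps)

lemma curvature_frame: "curvature \<A> D (E x) (E y) (E z) = lincomb (\<rho> x y) (\<lambda>k. D (E k) (E z))"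
  unfolding curvature_def connection_commutator bracket connection_left[OF frame_field] frame_curvature_def
  by (simp add: lincomb_append lincomb_negate)

text \<open>The first and last terms of the covariant derivative combine to the commutator of D (E
  w) with R(E x, E y), which \<open>c\<close> expresses through the D (E k). All terms are then
  combinations of the \<open>D (E k) (E z)\<close> with coefficients free of z, and
  \<open>parallel\<close> makes them cancel.\<close>

lemma nabla_curvature_frame: "nabla_curvature \<A> D (E w) (E x) (E y) (E z) = 0"
proof -
  let ?N = "\<lambda>k. D (E k) (E z)"
  note [simp] = frame_field connection_field
  have 1: "D (E w) (curvature \<A> D (E x) (E y) (E z)) = lincomb (\<rho> x y) (\<lambda>k. D (E w) (?N k))"
    by (simp add: curvature_frame connection_right)
  have "curvature \<A> D (E x) (E y) (D (E w) (E z))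
      = lincomb (\<Gamma> w z) (\<lambda>m. lincomb (\<rho> x y) (\<lambda>k. D (E k) (E m)))"
    unfolding connection_frame[of w z]
    by (subst real_linear_lincomb[OF real_linear_curvature(3)]) (simp_all add: curvature_frame)
  \<comment> \<open>R(E x, E y) acts on every frame vector in \<open>D (E w) (E z)\<close> with the
    same coefficients, so the two sums can be exchanged.\<close>
  also have "\<dots> = lincomb (\<rho> x y) (\<lambda>k. D (E k) (D (E w) (E z)))"
    unfolding connection_frame[of w z] by (simp add: connection_right lincomb_swap[of "\<Gamma> w z"])
  finally have 2: "curvature \<A> D (E x) (E y) (D (E w) (E z))
      = lincomb (\<rho> x y) (\<lambda>k. D (E k) (D (E w) (E z)))" .
  have 3: "curvature \<A> D (D (E w) (E x)) (E y) (E z) = lincomb (\<Gamma> w x) (\<lambda>i. lincomb (\<rho> i y) ?N)"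
    unfolding connection_frame[of w x]
    by (subst real_linear_lincomb[OF real_linear_curvature(1)]) (simp_all add: curvature_frame)
  have 4: "curvature \<A> D (E x) (D (E w) (E y)) (E z) = lincomb (\<Gamma> w y) (\<lambda>i. lincomb (\<rho> x i) ?N)"
    unfolding connection_frame[of w y]
    by (subst real_linear_lincomb[OF real_linear_curvature(2)]) (simp_all add: curvature_frame)
  have "lincomb (\<rho> x y) (\<lambda>k. D (E w) (?N k)) - lincomb (\<rho> x y) (\<lambda>k. D (E k) (D (E w) (E z)))
      = lincomb (\<rho> x y) (\<lambda>k. lincomb (c w k) ?N)"
    unfolding lincomb_diff[symmetric] connection_commutator ..
  then show ?thesis
    using lincomb_vanishes[OF parallel[of x y w], of ?N]
    unfolding nabla_curvature_def 1 2 3 4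
    by (simp add: lincomb_append lincomb_negate lincomb_expand algebra_simps)
qed

end


section \<open>Structure constants of the Lie algebra\<close>

text \<open>In the basis \<open>T i = l_scale i *\<^sub>R axis i 1\<close> the brackets, the Levi-Civita connection
  (obtained from the Koszul formula) and the commutators of the operators \<open>D (T i)\<close> all have integer
  coefficients. The squared length of \<open>T i\<close> is \<open>l_norm\<close>; \<open>e1\<close> and \<open>e2\<close> are the two signs.\<close>

definition l_scale :: "l_index \<Rightarrow> real" where
  "l_scale i = (if i \<in> {A, B, V1, U1} then 2 * sqrt 3 else 2)"

definition l_structure :: "l_index \<Rightarrow> l_index \<Rightarrow> (int \<times> l_index) list" where
  "l_structure i j = (case i of
      V2 \<Rightarrow> (case j of U2 \<Rightarrow> [(- 2, V2)] | _ \<Rightarrow> [])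
    | U2 \<Rightarrow> (case j of V2 \<Rightarrow> [(2, V2)] | V0 \<Rightarrow> [(1, V0)] | V1 \<Rightarrow> [(1, V1)] | U0 \<Rightarrow> [(1, U0)] | U1 \<Rightarrow> [(1, U1)] | _ \<Rightarrow> [])
    | A \<Rightarrow> (case j of B \<Rightarrow> [(- 2, A)] | V0 \<Rightarrow> [(2, V1)] | V1 \<Rightarrow> [(- 4, U1)] | U1 \<Rightarrow> [(- 6, U0)] | _ \<Rightarrow> [])
    | B \<Rightarrow> (case j of A \<Rightarrow> [(2, A)] | V0 \<Rightarrow> [(- 3, V0)] | V1 \<Rightarrow> [(- 1, V1)] | U0 \<Rightarrow> [(3, U0)] | U1 \<Rightarrow> [(1, U1)] | _ \<Rightarrow> [])
    | V0 \<Rightarrow> (case j of U2 \<Rightarrow> [(- 1, V0)] | A \<Rightarrow> [(- 2, V1)] | B \<Rightarrow> [(3, V0)] | U0 \<Rightarrow> [(- 2, V2)] | _ \<Rightarrow> [])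
    | V1 \<Rightarrow> (case j of U2 \<Rightarrow> [(- 1, V1)] | A \<Rightarrow> [(4, U1)] | B \<Rightarrow> [(1, V1)] | U1 \<Rightarrow> [(- 6, V2)] | _ \<Rightarrow> [])
    | U0 \<Rightarrow> (case j of U2 \<Rightarrow> [(- 1, U0)] | B \<Rightarrow> [(- 3, U0)] | V0 \<Rightarrow> [(2, V2)] | _ \<Rightarrow> [])
    | U1 \<Rightarrow> (case j of U2 \<Rightarrow> [(- 1, U1)] | A \<Rightarrow> [(6, U0)] | B \<Rightarrow> [(- 1, U1)] | V1 \<Rightarrow> [(6, V2)] | _ \<Rightarrow> []))"

definition l_connection :: "int \<Rightarrow> int \<Rightarrow> l_index \<Rightarrow> l_index \<Rightarrow> (int \<times> l_index) list" where
  "l_connection e1 e2 i j = (case i of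
      V2 \<Rightarrow> (case j of V2 \<Rightarrow> [(- (2 * e1), U2)] | U2 \<Rightarrow> [(- 2, V2)] | V0 \<Rightarrow> [(e1 * e2, U0)] | V1 \<Rightarrow> [(- e2, U1)] | U0 \<Rightarrow> [(e2, V0)] | U1 \<Rightarrow> [(- (e1 * e2), V1)] | _ \<Rightarrow> [])
    | U2 \<Rightarrow> []
    | A \<Rightarrow> (case j of A \<Rightarrow> [(- (2 * e1), B)] | B \<Rightarrow> [(- 2, A)] | V0 \<Rightarrow> [(1, V1)] | V1 \<Rightarrow> [(3 * e1, V0), (- 2, U1)] | U0 \<Rightarrow> [(- e1, U1)] | U1 \<Rightarrow> [(- (2 * e1), V1), (- 3, U0)] | _ \<Rightarrow> [])
    | B \<Rightarrow> []
    | V0 \<Rightarrow> (case j of V2 \<Rightarrow> [(e1 * e2, U0)] | U2 \<Rightarrow> [(- 1, V0)] | A \<Rightarrow> [(- 1, V1)] | B \<Rightarrow> [(3, V0)] | V0 \<Rightarrow> [(e1 * e2, U2), (- (e1 * e2), B)] | V1 \<Rightarrow> [(e1 * e2, A)] | U0 \<Rightarrow> [(- 1, V2)] | _ \<Rightarrow> [])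
    | V1 \<Rightarrow> (case j of V2 \<Rightarrow> [(- e2, U1)] | U2 \<Rightarrow> [(- 1, V1)] | A \<Rightarrow> [(3 * e1, V0), (2, U1)] | B \<Rightarrow> [(1, V1)] | V0 \<Rightarrow> [(e1 * e2, A)] | V1 \<Rightarrow> [(- (3 * e2), U2), (e2, B)] | U1 \<Rightarrow> [(- 3, V2), (2 * e2, A)] | _ \<Rightarrow> [])
    | U0 \<Rightarrow> (case j of V2 \<Rightarrow> [(e2, V0)] | U2 \<Rightarrow> [(- 1, U0)] | A \<Rightarrow> [(- e1, U1)] | B \<Rightarrow> [(- 3, U0)] | V0 \<Rightarrow> [(1, V2)] | U0 \<Rightarrow> [(- e2, U2), (- e2, B)] | U1 \<Rightarrow> [(- (e1 * e2), A)] | _ \<Rightarrow> [])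
    | U1 \<Rightarrow> (case j of V2 \<Rightarrow> [(- (e1 * e2), V1)] | U2 \<Rightarrow> [(- 1, U1)] | A \<Rightarrow> [(- (2 * e1), V1), (3, U0)] | B \<Rightarrow> [(- 1, U1)] | V1 \<Rightarrow> [(3, V2), (2 * e2, A)] | U0 \<Rightarrow> [(- (e1 * e2), A)] | U1 \<Rightarrow> [(3 * e1 * e2, U2), (e1 * e2, B)] | _ \<Rightarrow> []))"

text \<open>The rows of \<open>l_connection\<close> at U2 and B are empty, so D (T U2) and D (T B)
  are zero; the other six operators are closed under commutators, and no entry involves U2 or
  B.\<close>

definition l_commutator :: "int \<Rightarrow> int \<Rightarrow> l_index \<Rightarrow> l_index \<Rightarrow> (int \<times> l_index) list" where
  "l_commutator e1 e2 i j = (case i of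
      V2 \<Rightarrow> (case j of V0 \<Rightarrow> [(- (e1 * e2), U0)] | V1 \<Rightarrow> [(e2, U1)] | U0 \<Rightarrow> [(- e2, V0)] | U1 \<Rightarrow> [(e1 * e2, V1)] | _ \<Rightarrow> [])
    | U2 \<Rightarrow> []
    | A \<Rightarrow> (case j of V0 \<Rightarrow> [(1, V1)] | V1 \<Rightarrow> [(3 * e1, V0), (- 2, U1)] | U0 \<Rightarrow> [(- e1, U1)] | U1 \<Rightarrow> [(- (2 * e1), V1), (- 3, U0)] | _ \<Rightarrow> [])
    | B \<Rightarrow> []
    | V0 \<Rightarrow> (case j of V2 \<Rightarrow> [(e1 * e2, U0)] | A \<Rightarrow> [(- 1, V1)] | V1 \<Rightarrow> [(e1 * e2, A)] | U0 \<Rightarrow> [(- 1, V2)] | _ \<Rightarrow> [])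
    | V1 \<Rightarrow> (case j of V2 \<Rightarrow> [(- e2, U1)] | A \<Rightarrow> [(- (3 * e1), V0), (2, U1)] | V0 \<Rightarrow> [(- (e1 * e2), A)] | U1 \<Rightarrow> [(- 3, V2), (2 * e2, A)] | _ \<Rightarrow> [])
    | U0 \<Rightarrow> (case j of V2 \<Rightarrow> [(e2, V0)] | A \<Rightarrow> [(e1, U1)] | V0 \<Rightarrow> [(1, V2)] | U1 \<Rightarrow> [(e1 * e2, A)] | _ \<Rightarrow> [])
    | U1 \<Rightarrow> (case j of V2 \<Rightarrow> [(- (e1 * e2), V1)] | A \<Rightarrow> [(2 * e1, V1), (3, U0)] | V1 \<Rightarrow> [(3, V2), (- (2 * e2), A)] | U0 \<Rightarrow> [(- (e1 * e2), A)] | _ \<Rightarrow> []))"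

definition l_norm :: "int \<Rightarrow> int \<Rightarrow> l_index \<Rightarrow> int" where
  "l_norm e1 e2 i = (case i of V2 \<Rightarrow> - 4 * e1 | U2 \<Rightarrow> 4 | A \<Rightarrow> - 12 * e1 | B \<Rightarrow> 12
     | V0 \<Rightarrow> 4 * e1 * e2 | V1 \<Rightarrow> - 12 * e2 | U0 \<Rightarrow> - 4 * e2 | U1 \<Rightarrow> 12 * e1 * e2)"

section \<open>Evaluation of the integer identities\<close>

definition l_indices :: "l_index list" where
  "l_indices = [V2, U2, A, B, V0, V1, U0, U1]"

definition l_signs :: "(int \<times> int) list" where
  "l_signs = [(- 1, - 1), (- 1, 1), (1, - 1)]"

text \<open>The quantifiers run over lists so that evaluation can unfold them;
  \<open>set_l_indices\<close> turns them into statements about all indices. As the Koszul formula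
  determines the connection, this certifies the table.\<close>

lemma l_connection_koszul:
  "\<forall>(e1, e2)\<in>set l_signs. \<forall>i\<in>set l_indices. \<forall>j\<in>set l_indices. \<forall>k\<in>set l_indices.
    2 * l_norm e1 e2 k * coefficient (l_connection e1 e2 i j) k
      = l_norm e1 e2 k * coefficient (l_structure i j) k
        - l_norm e1 e2 i * coefficient (l_structure j k) i
        + l_norm e1 e2 j * coefficient (l_structure k i) j"
  by code_simp

lemma l_connection_commutators:
  "\<forall>(e1, e2)\<in>set l_signs. \<forall>i\<in>set l_indices. \<forall>j\<in>set l_indices. \<forall>z\<in>set l_indices.
    vanishes (expand (l_connection e1 e2 j z) (l_connection e1 e2 i)
      @ negate (expand (l_connection e1 e2 i z) (l_connection e1 e2 j))
      @ negate (expand (l_commutator e1 e2 i j) (\<lambda>k. l_connection e1 e2 k z)))"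
  by code_simp

text \<open>This is [D_w, R(x,y)] = R(D_w x, y) + R(x, D_w y), compared on formal combinations of
  the operators D (T k); three indices suffice.\<close>

lemma l_curvature_parallel:
  "\<forall>(e1, e2)\<in>set l_signs. \<forall>w\<in>set l_indices. \<forall>x\<in>set l_indices. \<forall>y\<in>set l_indices.
    vanishes (expand (frame_curvature l_structure (l_commutator e1 e2) x y) (l_commutator e1 e2 w)
      @ negate (expand (l_connection e1 e2 w x)
          (\<lambda>i. frame_curvature l_structure (l_commutator e1 e2) i y))
      @ negate (expand (l_connection e1 e2 w y)
          (frame_curvature l_structure (l_commutator e1 e2) x)))"
  by code_simp

lemma set_l_indices: "set l_indices = UNIV"
  unfolding l_indices_def by (auto intro: l_index.exhaust)

lemma card_l_index: "CARD(l_index) = 8"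
proof -
  have "card (set l_indices) = 8"
    by (simp add: l_indices_def)
  then show ?thesis
    by (simp add: set_l_indices)
qed

section \<open>Comparison of the given bracket and scalar product with the tables\<close>

lemma l_bracket_axis:
  "l_bracket (r *\<^sub>R axis i 1) (t *\<^sub>R axis j 1) = (r * t) *\<^sub>R (l_table i j - l_table j i)"
proof -
  have "l_bracket (r *\<^sub>R axis i 1) (t *\<^sub>R axis j 1)
      = (\<Sum>k\<in>UNIV. \<Sum>l\<in>UNIV. if j = l then (if i = k then (r * t) *\<^sub>R (l_table k l - l_table l k) else 0) else 0)"
    unfolding l_bracket_def by (intro sum.cong refl) (simp add: axis_def)
  then show ?thesis by simp
qed

lemma l_scalar_axis:
  "l_scalar \<epsilon>1 \<epsilon>2 \<epsilon> (r *\<^sub>R axis i 1) (t *\<^sub>R axis j 1) = (if i = j then r * t * l_gram \<epsilon>1 \<epsilon>2 \<epsilon> i else 0)"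
proof -
  have "l_scalar \<epsilon>1 \<epsilon>2 \<epsilon> (r *\<^sub>R axis i 1) (t *\<^sub>R axis j 1)
      = (\<Sum>k\<in>UNIV. if i = k then (if i = j then r * t * l_gram \<epsilon>1 \<epsilon>2 \<epsilon> k else 0) else 0)"
    unfolding l_scalar_def by (intro sum.cong refl) (auto simp: axis_def)
  then show ?thesis by simp
qed

lemma l_bracket_scaled:
  "l_bracket (l_scale i *\<^sub>R axis i 1) (l_scale j *\<^sub>R axis j 1)
    = (\<Sum>(a, k)\<leftarrow>l_structure i j. (of_int a * l_scale k) *\<^sub>R axis k 1)"
proof -
  \<comment> \<open>Moving sqrt 3 out of denominators gives both sides a common normal form in each
    of the 64 cases.\<close>
  have s: "sqrt 3 * sqrt 3 = (3 :: real)" "x / sqrt 3 = x * sqrt 3 / 3" for x :: real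
    by (simp_all add: field_simps)
  show ?thesis
    unfolding l_bracket_axis l_scale_def
    by (cases i; cases j; simp add: l_structure_def s scaleR_left_diff_distrib[symmetric]
        scaleR_add_left[symmetric])
qed

lemma l_scalar_scaled:
  "l_scalar (of_int e1) (of_int e2) (- of_int e1 * of_int e2) (l_scale i *\<^sub>R axis i 1) (l_scale j *\<^sub>R axis j 1)
    = (if i = j then of_int (l_norm e1 e2 i) else 0)"
  unfolding l_scalar_axis by (cases i) (auto simp: l_scale_def l_norm_def)

theorem corollary1:
  fixes \<A> :: "('a::{t2_space,second_countable_topology}, real ^ 8) atlas"
    and L :: "'a monoid"
    and \<Theta> :: "real ^ l_index \<Rightarrow> 'a vector_field"
    and g :: "'a metric_tensor"
    and \<epsilon>1 \<epsilon>2 \<epsilon> :: real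
  assumes "(\<epsilon>1, \<epsilon>2) \<in> {(- 1, - 1), (- 1, 1), (1, - 1)}"
    and "\<epsilon> = - \<epsilon>1 * \<epsilon>2"
    and "lie_group \<A> L"
    and "simply_connected (UNIV :: 'a set)"
    and "lie_algebra_iso \<A> L l_bracket \<Theta>"
    and "left_invariant_metric \<A> L g"
    and "\<And>u v. g \<one>\<^bsub>L\<^esub> (\<Theta> u \<one>\<^bsub>L\<^esub>) (\<Theta> v \<one>\<^bsub>L\<^esub>) = l_scalar \<epsilon>1 \<epsilon>2 \<epsilon> u v"
  shows "locally_symmetric \<A> g"
proof -
  \<comment> \<open>Integer copies of the signs make the evaluated tables applicable.\<close>
  obtain e1 e2 :: int where e: "\<epsilon>1 = of_int e1" "\<epsilon>2 = of_int e2" "(e1, e2) \<in> set l_signs"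
    using assms(1) that[of "- 1" "- 1"] that[of "- 1" 1] that[of 1 "- 1"]
    by (auto simp: l_signs_def)
  interpret smooth_manifold \<A>
    using assms(3) by unfold_locales (simp add: lie_group_def)
  interpret metric_manifold \<A> g
    using assms(6) by unfold_locales (simp add: left_invariant_metric_def)
  have \<Theta>_left: "\<Theta> u \<in> left_invariant_fields \<A> L" for u
    using assms(5) unfolding lie_algebra_iso_def bij_betw_def by blast
  have \<Theta>_field: "\<Theta> u \<in> vector_fields \<A>" for u
    using \<Theta>_left unfolding left_invariant_fields_def by blast
  have \<Theta>_add: "\<Theta> (u + v) = \<Theta> u + \<Theta> v" and \<Theta>_scale: "\<Theta> (r *\<^sub>R u) = fun_scale (\<lambda>_. r) (\<Theta> u)"
    and \<Theta>_bracket: "\<Theta> (l_bracket u v) = lie_bracket \<A> (\<Theta> u) (\<Theta> v)" for u v r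
    using assms(5) unfolding lie_algebra_iso_def by blast+
  \<comment> \<open>Left translation by p carries the identity to p and preserves both the fields
    and the metric, so the inner product at p is the one at the identity.\<close>
  have \<Theta>_inner: "g p (\<Theta> u p) (\<Theta> v p) = l_scalar \<epsilon>1 \<epsilon>2 \<epsilon> u v" for p u v
  proof -
    have p: "p \<otimes>\<^bsub>L\<^esub> \<one>\<^bsub>L\<^esub> = p"
      using assms(3) unfolding lie_group_def by (simp add: group.is_monoid monoid.r_one)
    have push: "push_forward \<A> (\<lambda>x. p \<otimes>\<^bsub>L\<^esub> x) \<one>\<^bsub>L\<^esub> (\<Theta> w \<one>\<^bsub>L\<^esub>) = \<Theta> w p" for w
      using \<Theta>_left[of w] p unfolding left_invariant_fields_def by force
    have "g (p \<otimes>\<^bsub>L\<^esub> \<one>\<^bsub>L\<^esub>) (push_forward \<A> (\<lambda>x. p \<otimes>\<^bsub>L\<^esub> x) \<one>\<^bsub>L\<^esub> (\<Theta> u \<one>\<^bsub>L\<^esub>))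
        (push_forward \<A> (\<lambda>x. p \<otimes>\<^bsub>L\<^esub> x) \<one>\<^bsub>L\<^esub> (\<Theta> v \<one>\<^bsub>L\<^esub>)) = g \<one>\<^bsub>L\<^esub> (\<Theta> u \<one>\<^bsub>L\<^esub>) (\<Theta> v \<one>\<^bsub>L\<^esub>)"
      using assms(6) vector_field_tangent[OF \<Theta>_field] unfolding left_invariant_metric_def by blast
    then show ?thesis
      unfolding push p assms(7) .
  qed
  define E where "E i = \<Theta> (l_scale i *\<^sub>R axis i 1)" for i
  have \<Theta>_sum: "\<Theta> (\<Sum>(a, k)\<leftarrow>xs. (of_int a * l_scale k) *\<^sub>R axis k 1) = lincomb xs E" for xs
  proof (induction xs)
    case Nil
    then show ?case
      using \<Theta>_add[of 0 0] by (simp add: lincomb_Nil)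
  next
    case (Cons x xs)
    then show ?case
      by (cases x)
        (simp only: list.map sum_list.Cons prod.case \<Theta>_add lincomb_Cons E_def \<Theta>_scale scaleR_scaleR[symmetric])
  qed
  show ?thesis
    unfolding locally_symmetric_def
  proof (intro allI impI ballI)
    fix D W X Y Z
    assume D: "levi_civita_connection \<A> g D"
      and fields: "W \<in> vector_fields \<A>" "X \<in> vector_fields \<A>" "Y \<in> vector_fields \<A>" "Z \<in> vector_fields \<A>"
    interpret closed_frame \<A> g E "\<lambda>i. of_int (l_norm e1 e2 i)" D l_structure
      "l_connection e1 e2" "l_commutator e1 e2"
    proof
      \<comment> \<open>The group is modelled on \<open>real ^ 8\<close>, its Lie algebra on
        \<open>real ^ l_index\<close>; the frame argument compares the two dimensions.\<close>
      show "DIM(real ^ 8) = CARD(l_index)"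
        by (simp add: card_l_index)
      show "E i \<in> vector_fields \<A>" for i
        unfolding E_def by (rule \<Theta>_field)
      show "g p (E i p) (E j p) = (if i = j then of_int (l_norm e1 e2 i) else 0)" for p i j
        unfolding E_def \<Theta>_inner assms(2) e(1,2) by (rule l_scalar_scaled)
      show "real_of_int (l_norm e1 e2 i) \<noteq> 0" for i
        using e(3) by (cases i) (auto simp: l_norm_def l_signs_def)
      show "levi_civita_connection \<A> g D"
        by (rule D)
      show "lie_bracket \<A> (E i) (E j) = lincomb (l_structure i j) E" for i j
        unfolding E_def \<Theta>_bracket[symmetric] l_bracket_scaled \<Theta>_sum[unfolded E_def] ..
      show "2 * real_of_int (l_norm e1 e2 k) * of_int (coefficient (l_connection e1 e2 i j) k)
          = of_int (l_norm e1 e2 k) * of_int (coefficient (l_structure i j) k)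
            - of_int (l_norm e1 e2 i) * of_int (coefficient (l_structure j k) i)
            + of_int (l_norm e1 e2 j) * of_int (coefficient (l_structure k i) j)" for i j k
      proof -
        have "2 * l_norm e1 e2 k * coefficient (l_connection e1 e2 i j) k
          = l_norm e1 e2 k * coefficient (l_structure i j) k
            - l_norm e1 e2 i * coefficient (l_structure j k) i
            + l_norm e1 e2 j * coefficient (l_structure k i) j"
          using bspec[OF l_connection_koszul e(3)] by (simp add: set_l_indices)
        from arg_cong[OF this, of real_of_int] show ?thesis
          by simp
      qed
    \<comment> \<open>What remains are \<open>commutators\<close> and \<open>parallel\<close>,
      instances of the evaluated identities.\<close>
    qed (use bspec[OF l_connection_commutators e(3)] bspec[OF l_curvature_parallel e(3)]
        in \<open>simp_all add: set_l_indices\<close>)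
    show "nabla_curvature \<A> D W X Y Z = 0"
      by (rule nabla_curvature_eq_0[OF nabla_curvature_frame fields])
  qed
qed

end
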